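(* Consider any one of the following processes: the Twinning process; a $k$-Relative-Threshold$(f_1,\dots,f_k)$ process with any $k\ge1$ and $f_k=0$ (this includes Mean-Thinning); the $(1+\beta)$-process with any constant $\beta\in(0,1]$. Then there exists a constant $\kappa>0$ (different for each process, independent of $n$ and $m$) such that for all sufficiently large $n$ and any round $m\ge0$, $$\Pr[\mathrm{Gap}(m)\le\kappa\log n]\ge1-n^{-4}.$$
   Context: All processes act on $n$ bins and start with the empty load vector $x^0=(0,\dots,0)$; $x^t$ is the load vector after $t$ rounds, $W^t=\sum_ix_i^t$ and $\mathrm{Gap}(t)=\max_{i\in[n]}x_i^t-W^t/n$. Twinning: in each round $t\ge0$ sample one bin $i$ uniformly at random; allocate two balls to $i$ if $x_i^t<W^t/n$, and one ball to $i$ if $x_i^t\ge W^t/n$. $k$-Relative-Threshold$(f_1,\dots,f_k)$ ($k$ a fixed integer): the $f_j$ are functions of $n$ with $\infty=f_0(n)>f_1(n)>\dots>f_k(n)$ for every $n$. In each round $t\ge0$ sample two bins $i_1,i_2$ independently and uniformly at random; let $\ell_i^t=\max\{j\in\{0,1,\dots,k\}:\frac tn+f_j(n)>x_i^t\}$ for $i\in\{i_1,i_2\}$. If $\ell_{i_1}^t\ge\ell_{i_2}^t$ allocate one ball to $i_1$, otherwise allocate one ball to $i_2$. Mean-Thinning: in each round $t$ sample $i_1,i_2$ independently and uniformly; allocate one ball to $i_1$ if $x_{i_1}^t<t/n$, otherwise one ball to $i_2$. $(1+\beta)$-process: in each round, with probability $\beta$ sample two bins independently and uniformly and allocate one ball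 to the less loaded of the two (ties in favour of the bin with higher index); otherwise allocate one ball to a single uniformly sampled bin. *)

theory Defs
  imports "HOL-Probability.Probability"
begin

text \<open>
  The \<open>n\<close> bins are \<open>1, \<dots>, n\<close>; only the values of a load vector on these indices matter.
  An allocation process on \<open>n\<close> bins is given by the distribution of the next load vector,
  depending on \<open>n\<close>, the round \<open>t\<close> and the load vector after \<open>t\<close> rounds.
\<close>

type_synonym loads = "nat \<Rightarrow> nat"

type_synonym alloc_process = "nat \<Rightarrow> nat \<Rightarrow> loads \<Rightarrow> loads pmf"

primrec load_pmf :: "alloc_process \<Rightarrow> nat \<Rightarrow> nat \<Rightarrow> loads pmf" where
  "load_pmf P n 0 = return_pmf (\<lambda>_. 0)"
| "load_pmf P n (Suc t) = bind_pmf (load_pmf P n t) (P n t)"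

definition total_load :: "nat \<Rightarrow> loads \<Rightarrow> nat" where
  "total_load n x = (\<Sum>i\<in>{1..n}. x i)"

definition gap :: "nat \<Rightarrow> loads \<Rightarrow> real" where
  "gap n x = Max ((\<lambda>i. real (x i)) ` {1..n}) - real (total_load n x) / real n"

definition add_balls :: "nat \<Rightarrow> nat \<Rightarrow> loads \<Rightarrow> loads" where
  "add_balls b i x = x(i := x i + b)"

definition one_sample :: "nat \<Rightarrow> nat pmf" where
  "one_sample n = pmf_of_set {1..n}"

definition two_samples :: "nat \<Rightarrow> (nat \<times> nat) pmf" where
  "two_samples n = pair_pmf (one_sample n) (one_sample n)"

definition twinning :: alloc_process where
  "twinning n t x =
     map_pmf (\<lambda>i. add_balls
         (if real (x i) < real (total_load n x) / real n then 2 else 1) i x)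
       (one_sample n)"

text \<open>
  Thresholds \<open>f j n\<close> are extended reals so that the convention \<open>f\<^sub>0 = \<infinity>\<close> can be taken literally;
  it makes the set in \<open>level\<close> contain \<open>0\<close>.
\<close>

definition relative_thresholds :: "nat \<Rightarrow> (nat \<Rightarrow> nat \<Rightarrow> ereal) \<Rightarrow> bool" where
  "relative_thresholds k f \<longleftrightarrow>
     (\<forall>n\<ge>1. f 0 n = \<infinity> \<and> (\<forall>j<k. f j n > f (Suc j) n))"

definition level :: "nat \<Rightarrow> (nat \<Rightarrow> nat \<Rightarrow> ereal) \<Rightarrow> nat \<Rightarrow> nat \<Rightarrow> loads \<Rightarrow> nat \<Rightarrow> nat" where
  "level k f n t x i =
     Max {j \<in> {0..k}. ereal (real t / real n) + f j n > ereal (real (x i))}"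

definition relative_threshold :: "nat \<Rightarrow> (nat \<Rightarrow> nat \<Rightarrow> ereal) \<Rightarrow> alloc_process" where
  "relative_threshold k f n t x =
     map_pmf (\<lambda>(i1, i2). add_balls 1
         (if level k f n t x i1 \<ge> level k f n t x i2 then i1 else i2) x)
       (two_samples n)"

definition mean_thinning :: alloc_process where
  "mean_thinning n t x =
     map_pmf (\<lambda>(i1, i2). add_balls 1 (if real (x i1) < real t / real n then i1 else i2) x)
       (two_samples n)"

definition less_loaded :: "loads \<Rightarrow> nat \<Rightarrow> nat \<Rightarrow> nat" where
  "less_loaded x i1 i2 =
     (if x i1 < x i2 then i1 else if x i2 < x i1 then i2 else max i1 i2)"

definition one_plus_beta :: "real \<Rightarrow> alloc_process" where
  "one_plus_beta \<beta> n t x =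
     bind_pmf (bernoulli_pmf \<beta>) (\<lambda>b.
       if b then map_pmf (\<lambda>(i1, i2). add_balls 1 (less_loaded x i1 i2) x) (two_samples n)
       else map_pmf (\<lambda>i. add_balls 1 i x) (one_sample n))"

end

theory Submission
  imports Defs "HOL-Real_Asymp.Real_Asymp"
begin

text \<open>
  Write \<open>y\<^sub>j = x\<^sub>j - W/n\<close>. In all the processes the expected change \<open>b\<^sub>j\<close> of \<open>y\<^sub>j\<close> decreases with the load
  and its sum over the overloaded bins is at most \<open>-\<beta>\<delta>(1 - \<delta>)\<close>, where \<open>\<delta>\<close> is the fraction of overloaded bins.

  As \<open>\<delta>(1 - \<delta>)\<close> may be of order \<open>1/n\<close>, the potential \<open>V = \<Sum>\<^sub>j cosh (a y\<^sub>j)\<close> contracts unconditionally only for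
  \<open>a\<close> of order \<open>1/n\<close>, which gives the preliminary bound \<open>\<bar>y\<^sub>j\<bar> = O(n log n)\<close>. For larger \<open>a\<close> the growth of \<open>V\<close>,
  at relative rate \<open>O(a\<^sup>2/n)\<close>, is compensated by a factor \<open>exp (\<lambda> \<Sum>\<^sub>j g y\<^sub>j)\<close> with \<open>\<lambda>\<close> of order \<open>a\<^sup>2/n\<close> and \<open>g\<close> a
  double well: \<open>g\<close> is the square minus a multiple of a Huber function. If \<open>\<Sum>\<^sub>j \<bar>y\<^sub>j\<bar>\<close> is large compared with \<open>n\<close>,
  the quadratic part of \<open>g\<close> makes the exponent drift down. If it is not, either the bias is of order \<open>1/n\<close>
  on all bins far from the mean and \<open>V\<close> itself contracts, or \<open>\<Sum>\<^sub>j \<bar>b\<^sub>j\<bar>\<close> is small and the exponent drifts down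
  because \<open>g\<close> is concave near \<open>0\<close>, where most of the bins are.

  The second-order terms are under control when \<open>a\<^sup>2 max\<^sub>j \<bar>y\<^sub>j\<bar>/n\<close> is small, and the combined potential then yields
  \<open>\<bar>y\<^sub>j\<bar> = O(log n/a)\<close>. With \<open>a = 1/log n\<close> this improves the bound \<open>O(n log n)\<close> to \<open>O(log\<^sup>2 n)\<close>, and then with
  constant \<open>a\<close> to \<open>O(log n)\<close>.
\<close>

section \<open>Elementary inequalities\<close>

text \<open>For negative \<open>s = -u\<close> the Taylor bound is applied to \<open>exp u\<close>:
  the product \<open>(1 - u + u^2) * (1 + u + u^2 / 2)\<close> is at least 1, so
  \<open>1 - u + u^2\<close> dominates the reciprocal of \<open>exp u\<close>.\<close>

lemma exp_le_quadratic:
  fixes s :: real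
  assumes "\<bar>s\<bar> \<le> 1"
  shows "exp s \<le> 1 + s + s\<^sup>2"
proof (cases "s \<ge> 0")
  case True
  then show ?thesis using assms exp_bound by auto
next
  case False
  define u where "u = - s"
  have u: "0 \<le> u" "u \<le> 1" using False assms by (auto simp: u_def)
  have "1 + u + u\<^sup>2 / 2 \<le> exp u" using u exp_lower_Taylor_quadratic by blast
  moreover have p: "0 < 1 - u + u\<^sup>2"
  proof (cases "u = 0")
    case False
    then have "0 < u\<^sup>2" by simp
    then show ?thesis using u by linarith
  qed simp
  ultimately have "(1 - u + u\<^sup>2) * (1 + u + u\<^sup>2 / 2) \<le> (1 - u + u\<^sup>2) * exp u"
    by (intro mult_left_mono) auto
  moreover have "(1 - u + u\<^sup>2) * (1 + u + u\<^sup>2 / 2) = 1 + u\<^sup>2 / 2 + u^3/2 + u^4/2"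
    by (simp add: field_simps power2_eq_square power3_eq_cube power4_eq_xxxx)
  ultimately have "1 + u\<^sup>2 / 2 + u^3/2 + u^4/2 \<le> (1 - u + u\<^sup>2) * exp u" by simp
  then have "1 \<le> (1 - u + u\<^sup>2) * exp u"
    using zero_le_power[OF u(1), of 2] zero_le_power[OF u(1), of 3] zero_le_power[OF u(1), of 4] by linarith
  then show ?thesis unfolding u_def by (simp add: exp_minus field_simps)
qed

text \<open>Both exponentials of cosh are expanded to second order. The linear terms recombine
  exactly to \<open>sinh a * s\<close>, the term through which the bias acts.\<close>

lemma cosh_add_le:
  fixes s :: real
  assumes "\<bar>s\<bar> \<le> 1"
  shows "cosh (a + s) \<le> cosh a * (1 + s\<^sup>2) + sinh a * s"
proof -
  have "exp a * exp s \<le> exp a * (1 + s + s\<^sup>2)"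
    using exp_le_quadratic[OF assms] by simp
  moreover have "exp (-a) * exp (-s) \<le> exp (-a) * (1 - s + s\<^sup>2)"
    using exp_le_quadratic[of "-s"] assms by simp
  moreover have "cosh (a + s) = (exp a * exp s + exp (-a) * exp (-s)) / 2"
    by (simp add: cosh_field_def mult_exp_exp)
  moreover have "(exp a * (1 + s + s\<^sup>2) + exp (-a) * (1 - s + s\<^sup>2)) / 2 = cosh a * (1 + s\<^sup>2) + sinh a * s"
    by (simp add: cosh_field_def sinh_field_def field_simps)
  ultimately show ?thesis by argo
qed

lemma abs_sinh_le_cosh: "\<bar>sinh (z::real)\<bar> \<le> cosh z"
  using cosh_plus_sinh[of z] cosh_minus_sinh[of z] exp_gt_zero[of z] exp_gt_zero[of "-z"] by linarith

text \<open>\<open>cosh z - |sinh z|\<close> equals \<open>exp (- |z|)\<close>. This turns a drift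
  expressed by sinh back into one for the cosh potential.\<close>

lemma cosh_le_abs_sinh: "cosh (z::real) - 1 \<le> \<bar>sinh z\<bar>"
proof -
  have "cosh \<bar>z\<bar> - sinh \<bar>z\<bar> \<le> 1" by (simp only: cosh_minus_sinh) simp
  moreover have "sinh \<bar>z\<bar> = \<bar>sinh z\<bar>" by (cases "z \<ge> 0") (auto simp: abs_if)
  ultimately show ?thesis by simp
qed

lemma cosh_add_diff_le:
  fixes s :: real
  assumes "\<bar>s\<bar> \<le> 1"
  shows "\<bar>cosh (a + s) - cosh a\<bar> \<le> 2 * \<bar>s\<bar> * cosh a"
proof -
  have c: "cosh a > 0" by simp
  have "s\<^sup>2 \<le> \<bar>s\<bar>" using assms by (metis abs_ge_zero mult_left_le_one_le power2_abs power2_eq_square)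
  then have "cosh a * (1 + s\<^sup>2) \<le> cosh a * (1 + \<bar>s\<bar>)" using c by simp
  moreover have "\<bar>sinh a * s\<bar> \<le> cosh a * \<bar>s\<bar>"
    unfolding abs_mult by (intro mult_right_mono abs_sinh_le_cosh) auto
  moreover have "cosh a + sinh a * s \<le> cosh (a + s)"
  proof -
    have "exp a * (1 + s) \<le> exp a * exp s" "exp (-a) * (1 + (-s)) \<le> exp (-a) * exp (-s)"
      by (intro mult_left_mono exp_ge_add_one_self; simp)+
    moreover have "cosh (a + s) = (exp a * exp s + exp (-a) * exp (-s)) / 2"
      by (simp add: cosh_field_def mult_exp_exp)
    ultimately show ?thesis by (simp add: cosh_field_def sinh_field_def field_simps)
  qed
  moreover have "0 \<le> cosh a * \<bar>s\<bar>" using c by simp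
  moreover have "cosh (a + s) \<le> cosh a * (1 + s\<^sup>2) + sinh a * s" by (rule cosh_add_le[OF assms])
  ultimately have "\<bar>cosh (a + s) - cosh a\<bar> \<le> cosh a * \<bar>s\<bar> + cosh a * \<bar>s\<bar>"
    unfolding distrib_left by (smt (verit))
  then show ?thesis by (simp add: mult_ac)
qed

lemma cosh_ge_quadratic: "z\<^sup>2 / 4 \<le> cosh (z::real)"
proof -
  have "1 + \<bar>z\<bar> + \<bar>z\<bar>\<^sup>2 / 2 \<le> exp \<bar>z\<bar>" using exp_lower_Taylor_quadratic[of "\<bar>z\<bar>"] by simp
  moreover have "1 - \<bar>z\<bar> \<le> exp (- \<bar>z\<bar>)" using exp_ge_add_one_self[of "-\<bar>z\<bar>"] by simp
  ultimately have "z\<^sup>2 / 4 \<le> cosh \<bar>z\<bar>" unfolding cosh_field_def by simp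
  then show ?thesis by simp
qed

lemma exp_abs_le_cosh: "exp \<bar>z\<bar> \<le> 2 * cosh (z::real)"
proof -
  have "exp \<bar>z\<bar> \<le> 2 * cosh \<bar>z\<bar>" unfolding cosh_field_def by simp
  then show ?thesis by simp
qed

lemma sinh_le_2: "z \<le> 1 \<Longrightarrow> sinh (z::real) \<le> 2"
proof -
  assume "z \<le> 1"
  then have "exp z \<le> exp 1" by simp
  then have "exp z - exp (- z) \<le> 4" using exp_le exp_gt_zero[of "-z"] by linarith
  then show ?thesis unfolding sinh_field_def by simp
qed

text \<open>The double sum of \<open>(b i - b j) * (h i - h j)\<close> has no positive term.
  Monotonicity is measured along \<open>y\<close> to make ties harmless: where \<open>y\<close>
  agrees, \<open>b\<close> is arbitrary but \<open>h\<close> is constant.\<close>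

lemma Chebyshev_sum_on:
  fixes b h y :: "'a \<Rightarrow> real"
  assumes "\<And>i j. i \<in> S \<Longrightarrow> j \<in> S \<Longrightarrow> y i < y j \<Longrightarrow> b j \<le> b i"
    and "\<And>i j. i \<in> S \<Longrightarrow> j \<in> S \<Longrightarrow> y i \<le> y j \<Longrightarrow> h i \<le> h j"
  shows "real (card S) * (\<Sum>j\<in>S. b j * h j) \<le> (\<Sum>j\<in>S. b j) * (\<Sum>j\<in>S. h j)"
proof -
  have "(b i - b j) * (h i - h j) \<le> 0" if "i \<in> S" "j \<in> S" for i j
  proof (cases "y i" "y j" rule: linorder_cases)
    case less
    then show ?thesis using assms[OF that] by (intro mult_nonneg_nonpos) auto
  next
    case equal
    then have "h i = h j" using assms(2)[OF that] assms(2)[OF that(2) that(1)] by simp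
    then show ?thesis by simp
  next
    case greater
    then show ?thesis using assms[OF that(2) that(1)] by (intro mult_nonpos_nonneg) auto
  qed
  then have "(\<Sum>i\<in>S. \<Sum>j\<in>S. (b i - b j) * (h i - h j)) \<le> 0"
    by (intro sum_nonpos) auto
  moreover have "(\<Sum>i\<in>S. \<Sum>j\<in>S. (b i - b j) * (h i - h j))
     = 2 * (real (card S) * (\<Sum>j\<in>S. b j * h j)) - 2 * ((\<Sum>j\<in>S. b j) * (\<Sum>j\<in>S. h j))"
    by (simp add: left_diff_distrib right_diff_distrib sum_subtractf sum.distrib
        sum_distrib_left[symmetric] sum_distrib_right[symmetric] mult.commute)
  ultimately show ?thesis by linarith
qed

section \<open>Clipping and the Huber function\<close>

definition clip :: "real \<Rightarrow> real \<Rightarrow> real" where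
  "clip B y = max (- B) (min B y)"

text \<open>This is \<open>y^2\<close> on \<open>[-B, B]\<close> and
  \<open>2 * B * |y| - B^2\<close> outside, twice the usual Huber loss. Its derivative is
  \<open>2 * clip B y\<close>.\<close>

definition huber :: "real \<Rightarrow> real \<Rightarrow> real" where
  "huber B y = 2 * clip B y * y - (clip B y)\<^sup>2"

lemma abs_clip_le: "0 \<le> B \<Longrightarrow> \<bar>clip B y\<bar> \<le> B"
  by (auto simp: clip_def)

text \<open>\<open>huber B z\<close> is \<open>z^2\<close> minus the squared distance from
  \<open>z\<close> to \<open>[-B, B]\<close>. As \<open>clip B y\<close> is a point of that
  interval, it is no closer to \<open>z\<close> than \<open>clip B z\<close>.\<close>

lemma huber_ge_tangent:
  assumes "0 \<le> B"
  shows "huber B y + 2 * clip B y * d \<le> huber B (y + d)"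
proof -
  define z where "z = y + d"
  have "\<bar>z - clip B z\<bar> \<le> \<bar>z - clip B y\<bar>"
    using assms unfolding clip_def by linarith
  then have "(z - clip B z)\<^sup>2 \<le> (z - clip B y)\<^sup>2"
    by (simp add: abs_le_square_iff)
  then show ?thesis unfolding huber_def z_def[symmetric]
    by (simp add: z_def power2_eq_square algebra_simps)
qed

text \<open>The margin 2 bounds the change of a deviation in one round, so both points lie in the
  quadratic region.\<close>

lemma huber_inner:
  assumes "\<bar>y\<bar> \<le> B - 2" "\<bar>d\<bar> \<le> 2"
  shows "huber B (y + d) = huber B y + 2 * clip B y * d + d\<^sup>2"
proof -
  have "clip B y = y" "clip B (y + d) = y + d" using assms by (auto simp: clip_def)
  then show ?thesis by (simp add: huber_def power2_eq_square algebra_simps)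
qed

lemma huber_nonneg: "0 \<le> B \<Longrightarrow> 0 \<le> huber B y"
  using huber_ge_tangent[of B 0 y] by (simp add: huber_def clip_def)

lemma huber_lipschitz:
  assumes "0 \<le> B"
  shows "\<bar>huber B (y + d) - huber B y\<bar> \<le> 2 * B * \<bar>d\<bar>"
proof -
  have "\<bar>2 * clip B y * d\<bar> \<le> 2 * B * \<bar>d\<bar>" "\<bar>2 * clip B (y + d) * d\<bar> \<le> 2 * B * \<bar>d\<bar>"
    using abs_clip_le[OF assms] by (auto simp: abs_mult intro!: mult_right_mono)
  then show ?thesis
    using huber_ge_tangent[OF assms, of y d] huber_ge_tangent[OF assms, of "y + d" "-d"] by auto
qed

lemma huber_le:
  assumes "0 \<le> B"
  shows "huber B y \<le> 2 * B * \<bar>y\<bar>"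
proof -
  have "huber B 0 = 0" using assms by (simp add: huber_def clip_def)
  then show ?thesis using huber_lipschitz[OF assms, of 0 y] by simp
qed

section \<open>One step of an allocation with bias\<close>

declare One_nat_def [simp del]

text \<open>The common abstraction of all the processes: \<open>y\<close> holds the deviations from
  the mean load, and bin \<open>j\<close> receives \<open>w j\<close> balls with probability
  \<open>q j\<close>. \<open>rate_mono\<close> compares only strictly different loads, which leaves
  room for tie breaking by index.\<close>

locale biased_step =
  fixes n :: nat and y q w :: "nat \<Rightarrow> real" and \<beta> :: real
  assumes n_ge_2: "2 \<le> n"
    and beta_pos: "0 < \<beta>" and beta_le_1: "\<beta> \<le> 1"
    and sum_y: "(\<Sum>j\<in>{1..n}. y j) = 0"
    and sum_q: "(\<Sum>j\<in>{1..n}. q j) = 1"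
    and q_nonneg: "\<And>j. j \<in> {1..n} \<Longrightarrow> 0 \<le> q j"
    and q_le: "\<And>j. j \<in> {1..n} \<Longrightarrow> q j \<le> 2 / n"
    and w_ge_1: "\<And>j. j \<in> {1..n} \<Longrightarrow> 1 \<le> w j"
    and w_le_2: "\<And>j. j \<in> {1..n} \<Longrightarrow> w j \<le> 2"
    and rate_mono: "\<And>i j. i \<in> {1..n} \<Longrightarrow> j \<in> {1..n} \<Longrightarrow> y i < y j \<Longrightarrow> q j * w j \<le> q i * w i"
    and rate_over: "(\<Sum>j | j \<in> {1..n} \<and> 0 \<le> y j. q j * w j - (\<Sum>i\<in>{1..n}. q i * w i) / n)
        \<le> - \<beta> * card {j \<in> {1..n}. 0 \<le> y j} * card {j \<in> {1..n}. y j < 0} / n\<^sup>2"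
begin

text \<open>
  \<open>d i j\<close> is the change of \<open>y j\<close> when bin \<open>i\<close>, which has probability \<open>q i\<close>, receives \<open>w i\<close> balls;
  \<open>b j\<close> is its expectation.
\<close>

definition mean_w :: real where "mean_w = (\<Sum>i\<in>{1..n}. q i * w i)"
definition b :: "nat \<Rightarrow> real" where "b j = q j * w j - mean_w / n"
definition d :: "nat \<Rightarrow> nat \<Rightarrow> real" where "d i j = (if i = j then w i else 0) - w i / n"
definition over :: "nat set" where "over = {j \<in> {1..n}. 0 \<le> y j}"
definition under :: "nat set" where "under = {j \<in> {1..n}. y j < 0}"

lemma n_pos: "0 < real n" using n_ge_2 by simp

lemma over_under: "over \<union> under = {1..n}" "over \<inter> under = {}" "finite over" "finite under"
  by (auto simp: over_def under_def)

lemma sum_over_under: "(\<Sum>j\<in>{1..n}. f j) = (\<Sum>j\<in>over. f j) + (\<Sum>j\<in>under. f j)"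
  for f :: "nat \<Rightarrow> real"
  using sum.union_disjoint[OF over_under(3,4,2), of f] by (simp add: over_under(1))

lemma card_over_under: "real (card over) + real (card under) = n"
  using card_Un_disjoint[OF over_under(3,4,2)] by (simp add: over_under(1))

lemma mean_w_bounds: "0 \<le> mean_w" "mean_w \<le> 2"
proof -
  show "0 \<le> mean_w" unfolding mean_w_def
    using q_nonneg w_ge_1 by (intro sum_nonneg mult_nonneg_nonneg) fastforce+
  have "mean_w \<le> (\<Sum>i\<in>{1..n}. q i * 2)" unfolding mean_w_def
    using q_nonneg w_le_2 by (intro sum_mono mult_left_mono) auto
  then show "mean_w \<le> 2" using sum_q by (simp add: sum_distrib_right[symmetric])
qed

lemma sum_b: "(\<Sum>j\<in>{1..n}. b j) = 0"
  using n_pos by (simp add: b_def sum_subtractf mean_w_def)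

lemma rate_bounds:
  assumes "j \<in> {1..n}"
  shows "0 \<le> q j * w j" "q j * w j \<le> 4 / n"
proof -
  show "0 \<le> q j * w j" using q_nonneg[OF assms] w_ge_1[OF assms] by simp
  have "q j * w j \<le> (2 / n) * 2"
    using q_nonneg[OF assms] w_ge_1[OF assms] q_le[OF assms] w_le_2[OF assms]
    by (intro mult_mono) auto
  then show "q j * w j \<le> 4 / n" by simp
qed

lemma b_bounds:
  assumes "j \<in> {1..n}"
  shows "- 4 / n \<le> b j" "b j \<le> 4 / n"
proof -
  have "mean_w / n \<le> 4 / n" "0 \<le> mean_w / n" using mean_w_bounds n_pos
    by (auto simp: divide_le_cancel)
  then show "- 4 / n \<le> b j" "b j \<le> 4 / n" using rate_bounds[OF assms]
    unfolding b_def minus_divide_left[symmetric] by linarith+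
qed

lemma sum_abs_b: "(\<Sum>j\<in>{1..n}. \<bar>b j\<bar>) \<le> 4"
proof -
  have "(\<Sum>j\<in>{1..n}. \<bar>b j\<bar>) \<le> (\<Sum>j\<in>{1..n}. q j * w j + mean_w / n)"
    using rate_bounds mean_w_bounds n_pos unfolding b_def
    by (intro sum_mono) (auto intro!: order_trans[OF abs_triangle_ineq4])
  also have "\<dots> = 2 * mean_w" using n_pos by (simp add: sum.distrib mean_w_def)
  finally show ?thesis using mean_w_bounds by simp
qed

lemma b_mono: "i \<in> {1..n} \<Longrightarrow> j \<in> {1..n} \<Longrightarrow> y i < y j \<Longrightarrow> b j \<le> b i"
  using rate_mono by (simp add: b_def)

lemma sum_b_over: "(\<Sum>j\<in>over. b j) \<le> - \<beta> * card over * card under / n\<^sup>2"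
  using rate_over unfolding over_def under_def b_def mean_w_def by simp

text \<open>Chebyshev's inequality is applied to the overloaded and the underloaded bins separately.
  \<open>rate_over\<close> bounds the total bias of the former, and as all biases sum to 0 also that
  of the latter.\<close>

lemma sum_b_mono_le:
  fixes f :: "real \<Rightarrow> real"
  assumes f: "\<And>u v. u \<le> v \<Longrightarrow> f u \<le> f v" "\<And>u. 0 \<le> u \<Longrightarrow> 0 \<le> f u" "\<And>u. u < 0 \<Longrightarrow> f u \<le> 0"
  shows "(\<Sum>j\<in>{1..n}. b j * f (y j)) \<le>
     - (\<beta> / n\<^sup>2) * (card under * (\<Sum>j\<in>over. \<bar>f (y j)\<bar>) + card over * (\<Sum>j\<in>under. \<bar>f (y j)\<bar>))"
proof -
  have absf: "(\<Sum>j\<in>over. \<bar>f (y j)\<bar>) = (\<Sum>j\<in>over. f (y j))"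
     "(\<Sum>j\<in>under. \<bar>f (y j)\<bar>) = - (\<Sum>j\<in>under. f (y j))"
    unfolding sum_negf[symmetric] using f(2,3) by (intro sum.cong; auto simp: over_def under_def)+
  have ch: "card S * (\<Sum>j\<in>S. b j * f (y j)) \<le> (\<Sum>j\<in>S. b j) * (\<Sum>j\<in>S. f (y j))"
    if "S \<subseteq> {1..n}" for S
    by (rule Chebyshev_sum_on[where y = y]) (use that b_mono f(1) in \<open>blast+\<close>)
  have o: "(\<Sum>j\<in>over. b j * f (y j)) \<le> - (\<beta> / n\<^sup>2) * (card under * (\<Sum>j\<in>over. f (y j)))"
  proof (cases "over = {}")
    case False
    then have c: "0 < real (card over)" using over_under by (simp add: card_gt_0_iff)
    have "card over * (\<Sum>j\<in>over. b j * f (y j)) \<le> (\<Sum>j\<in>over. b j) * (\<Sum>j\<in>over. f (y j))"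
      by (rule ch) (use over_under in auto)
    also have "\<dots> \<le> (- \<beta> * card over * card under / n\<^sup>2) * (\<Sum>j\<in>over. f (y j))"
      using f(2) by (intro mult_right_mono sum_b_over sum_nonneg) (auto simp: over_def)
    also have "\<dots> = card over * (- (\<beta> / n\<^sup>2) * (card under * (\<Sum>j\<in>over. f (y j))))"
      by simp
    finally show ?thesis using c by (simp only: mult_le_cancel_left_pos)
  qed simp
  have u: "(\<Sum>j\<in>under. b j * f (y j)) \<le> (\<beta> / n\<^sup>2) * (card over * (\<Sum>j\<in>under. f (y j)))"
  proof (cases "under = {}")
    case False
    then have c: "0 < real (card under)" using over_under by (simp add: card_gt_0_iff)
    have "\<beta> * card over * card under / n\<^sup>2 \<le> (\<Sum>j\<in>under. b j)"
      using sum_b_over sum_b sum_over_under[of b] by simp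
    then have "(\<Sum>j\<in>under. b j) * (\<Sum>j\<in>under. f (y j))
        \<le> (\<beta> * card over * card under / n\<^sup>2) * (\<Sum>j\<in>under. f (y j))"
      using f(3) by (intro mult_right_mono_neg sum_nonpos) (auto simp: under_def)
    moreover have "card under * (\<Sum>j\<in>under. b j * f (y j)) \<le> (\<Sum>j\<in>under. b j) * (\<Sum>j\<in>under. f (y j))"
      by (rule ch) (use over_under in auto)
    ultimately have "card under * (\<Sum>j\<in>under. b j * f (y j))
        \<le> card under * ((\<beta> / n\<^sup>2) * (card over * (\<Sum>j\<in>under. f (y j))))"
      by (simp add: mult_ac)
    then show ?thesis using c by (simp only: mult_le_cancel_left_pos)
  qed simp
  show ?thesis unfolding absf sum_over_under[of "\<lambda>j. b j * f (y j)"]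
    using o u by (simp add: algebra_simps)
qed

text \<open>For the identity both sides carry the same mass, because the deviations sum to 0. The
  weights \<open>card under\<close> and \<open>card over\<close> then add up to \<open>n\<close>,
  which gives a rate of order \<open>1/n\<close> however unequal the sides are.\<close>

lemma sum_b_y: "(\<Sum>j\<in>{1..n}. b j * y j) \<le> - (\<beta> / (2 * n)) * (\<Sum>j\<in>{1..n}. \<bar>y j\<bar>)"
proof -
  define S where "S = (\<Sum>j\<in>over. \<bar>y j\<bar>)"
  have "(\<Sum>j\<in>over. \<bar>y j\<bar>) = (\<Sum>j\<in>over. y j)" "(\<Sum>j\<in>under. \<bar>y j\<bar>) = - (\<Sum>j\<in>under. y j)"
    unfolding sum_negf[symmetric] by (intro sum.cong; auto simp: over_def under_def)+
  then have S: "(\<Sum>j\<in>over. \<bar>y j\<bar>) = S" "(\<Sum>j\<in>under. \<bar>y j\<bar>) = S"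
    using sum_y sum_over_under[of y] by (auto simp: S_def)
  have "(\<Sum>j\<in>{1..n}. b j * y j) \<le> - (\<beta> / n\<^sup>2) * (card under * S + card over * S)"
    using sum_b_mono_le[of "\<lambda>u. u"] by (simp add: S)
  also have "\<dots> = - (\<beta> / n\<^sup>2) * (S * n)"
    by (simp add: card_over_under[symmetric] algebra_simps)
  also have "\<dots> = - (\<beta> / (2 * n)) * (S + S)" using n_pos by (simp add: power2_eq_square)
  finally show ?thesis unfolding sum_over_under[of "\<lambda>j. \<bar>y j\<bar>"] S .
qed

text \<open>The sinh masses of the two sides need not balance, so each weight is only bounded below
  by 1; hence the weaker rate \<open>\<beta> / n^2\<close>. Where a side is empty, the deviations
  summing to 0 settles the matter.\<close>

lemma sum_b_sinh:
  assumes "0 \<le> a"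
  shows "(\<Sum>j\<in>{1..n}. b j * sinh (a * y j)) \<le> - (\<beta> / n\<^sup>2) * (\<Sum>j\<in>{1..n}. \<bar>sinh (a * y j)\<bar>)"
proof -
  let ?f = "\<lambda>u. sinh (a * u)"
  have m: "(\<Sum>j\<in>{1..n}. b j * ?f (y j)) \<le>
     - (\<beta> / n\<^sup>2) * (card under * (\<Sum>j\<in>over. \<bar>?f (y j)\<bar>) + card over * (\<Sum>j\<in>under. \<bar>?f (y j)\<bar>))"
    by (rule sum_b_mono_le) (use assms in \<open>auto simp: mult_left_mono mult_nonneg_nonpos\<close>)
  have p: "0 \<le> (\<Sum>j\<in>over. \<bar>?f (y j)\<bar>)" "0 \<le> (\<Sum>j\<in>under. \<bar>?f (y j)\<bar>)"
    by (auto intro: sum_nonneg)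
  have "(\<Sum>j\<in>over. \<bar>?f (y j)\<bar>) \<le> card under * (\<Sum>j\<in>over. \<bar>?f (y j)\<bar>)"
  proof (cases "under = {}")
    case True
    then have o: "over = {1..n}" using over_under by auto
    then have "0 \<le> y j" if "j \<in> {1..n}" for j using that unfolding over_def by blast
    then have "\<forall>j\<in>{1..n}. y j = 0"
      using sum_nonneg_eq_0_iff[of "{1..n}" y] sum_y by blast
    then have "(\<Sum>j\<in>over. \<bar>?f (y j)\<bar>) = 0" using o by simp
    then show ?thesis by simp
  next
    case False
    then have "0 < card under" using over_under by (simp add: card_gt_0_iff)
    then have "1 \<le> real (card under)" by linarith
    then show ?thesis using mult_right_mono[OF _ p(1), of 1 "card under"] by simp
  qed
  moreover have "(\<Sum>j\<in>under. \<bar>?f (y j)\<bar>) \<le> card over * (\<Sum>j\<in>under. \<bar>?f (y j)\<bar>)"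
  proof (cases "over = {}")
    case True
    then have "under = {1..n}" using over_under by auto
    then have "y j < 0" if "j \<in> {1..n}" for j using that unfolding under_def by blast
    then have "(\<Sum>j\<in>{1..n}. y j) < (\<Sum>j\<in>{1..n}. 0)"
      using n_ge_2 by (intro sum_strict_mono) auto
    then show ?thesis using sum_y by simp
  next
    case False
    then have "0 < card over" using over_under by (simp add: card_gt_0_iff)
    then have "1 \<le> real (card over)" by linarith
    then show ?thesis using mult_right_mono[OF _ p(2), of 1 "card over"] by simp
  qed
  ultimately have "(\<beta> / n\<^sup>2) * (\<Sum>j\<in>{1..n}. \<bar>?f (y j)\<bar>)
     \<le> (\<beta> / n\<^sup>2) * (card under * (\<Sum>j\<in>over. \<bar>?f (y j)\<bar>) + card over * (\<Sum>j\<in>under. \<bar>?f (y j)\<bar>))"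
    using beta_pos unfolding sum_over_under[of "\<lambda>j. \<bar>?f (y j)\<bar>"] by (intro mult_left_mono) auto
  then show ?thesis using m by simp
qed

lemma sum_b_sinh_nonpos:
  assumes "0 \<le> a"
  shows "(\<Sum>j\<in>{1..n}. b j * sinh (a * y j)) \<le> 0"
proof -
  have "0 \<le> (\<beta> / n\<^sup>2) * (\<Sum>j\<in>{1..n}. \<bar>sinh (a * y j)\<bar>)"
    using beta_pos by (intro mult_nonneg_nonneg sum_nonneg) auto
  then show ?thesis using sum_b_sinh[OF assms] by linarith
qed

section \<open>Size and moments of the change in one round\<close>

lemma w_div_n: "i \<in> {1..n} \<Longrightarrow> 0 \<le> w i / n \<and> w i / n \<le> 2 / n \<and> w i / n \<le> 1"
  using w_ge_1[of i] w_le_2[of i] n_ge_2 by (auto simp: divide_le_cancel)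

lemma abs_d_le:
  assumes "i \<in> {1..n}"
  shows "\<bar>d i j\<bar> \<le> 2"
proof -
  define u where "u = w i / n"
  have "0 \<le> u" "u \<le> 1" using w_div_n[OF assms] by (auto simp: u_def)
  then show ?thesis using w_ge_1[OF assms] w_le_2[OF assms]
    unfolding d_def u_def[symmetric] by auto
qed

lemma sum_c_d:
  assumes "i \<in> {1..n}"
  shows "(\<Sum>j\<in>{1..n}. c j * d i j) = w i * c i - w i / n * (\<Sum>j\<in>{1..n}. c j)"
proof -
  have "(\<Sum>j\<in>{1..n}. c j * d i j) = (\<Sum>j\<in>{1..n}. (if i = j then w i * c i else 0) - w i / n * c j)"
    by (intro sum.cong) (auto simp: d_def algebra_simps)
  then show ?thesis using assms by (simp add: sum_subtractf sum_distrib_left)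
qed

lemma mean_d:
  assumes "j \<in> {1..n}"
  shows "(\<Sum>i\<in>{1..n}. q i * d i j) = b j"
proof -
  have "(\<Sum>i\<in>{1..n}. q i * d i j) = (\<Sum>i\<in>{1..n}. (if i = j then q j * w j else 0) - q i * w i / n)"
    by (intro sum.cong) (auto simp: d_def algebra_simps)
  then show ?thesis using assms by (simp add: sum_subtractf sum_divide_distrib b_def mean_w_def)
qed

lemma mean_sum_d: "(\<Sum>i\<in>{1..n}. q i * (\<Sum>j\<in>{1..n}. c j * d i j)) = (\<Sum>j\<in>{1..n}. c j * b j)"
proof -
  have "(\<Sum>i\<in>{1..n}. q i * (\<Sum>j\<in>{1..n}. c j * d i j)) = (\<Sum>j\<in>{1..n}. \<Sum>i\<in>{1..n}. c j * (q i * d i j))"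
    unfolding sum_distrib_left by (subst sum.swap) (simp add: mult_ac)
  also have "\<dots> = (\<Sum>j\<in>{1..n}. c j * b j)"
    unfolding sum_distrib_left[symmetric] by (intro sum.cong arg_cong2[where f = "(*)"] mean_d refl)
  finally show ?thesis .
qed

text \<open>A fixed bin receives balls with probability at most \<open>2/n\<close> and then changes
  by at most 2; otherwise only the mean moves, by at most \<open>2/n\<close>.\<close>

lemma mean_d_square:
  assumes j: "j \<in> {1..n}"
  shows "(\<Sum>i\<in>{1..n}. q i * (d i j)\<^sup>2) \<le> 12 / n"
proof -
  have "(d i j)\<^sup>2 \<le> (if i = j then 4 else 0) + 4 / n\<^sup>2" if i: "i \<in> {1..n}" for i
  proof (cases "i = j")
    case True
    have "\<bar>d i j\<bar>\<^sup>2 \<le> 2\<^sup>2" by (intro power_mono abs_d_le i) auto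
    then have "(d i j)\<^sup>2 \<le> 4" by simp
    moreover have "0 \<le> 4 / real n ^ 2" by simp
    ultimately show ?thesis unfolding if_P[OF True] of_nat_power by linarith
  next
    case False
    have "(w i / n)\<^sup>2 \<le> (2 / n)\<^sup>2" using w_div_n[OF i] by (intro power_mono) auto
    then show ?thesis using False by (simp add: d_def power_divide)
  qed
  then have "(\<Sum>i\<in>{1..n}. q i * (d i j)\<^sup>2) \<le> (\<Sum>i\<in>{1..n}. q i * ((if i = j then 4 else 0) + 4 / n\<^sup>2))"
    using q_nonneg by (intro sum_mono mult_left_mono) auto
  also have "\<dots> = (\<Sum>i\<in>{1..n}. if i = j then 4 * q i else 0) + (\<Sum>i\<in>{1..n}. q i) * (4 / n\<^sup>2)"
    unfolding sum_distrib_right sum.distrib[symmetric] by (intro sum.cong) (auto simp: algebra_simps)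
  also have "\<dots> = q j * 4 + 4 / n\<^sup>2" using j by (simp add: sum_q)
  also have "\<dots> \<le> 8 / n + 4 / n"
  proof -
    have "4 / real n ^ 2 \<le> 4 / n"
      using n_ge_2 by (intro divide_left_mono) (auto simp: power2_eq_square)
    then show ?thesis using q_le[OF j] by simp
  qed
  finally show ?thesis by simp
qed

section \<open>The hyperbolic cosine potential\<close>

definition V :: "real \<Rightarrow> real" where "V a = (\<Sum>j\<in>{1..n}. cosh (a * y j))"
definition V' :: "real \<Rightarrow> nat \<Rightarrow> real" where "V' a i = (\<Sum>j\<in>{1..n}. cosh (a * (y j + d i j)))"

lemma V_ge_n: "n \<le> V a"
  using sum_mono[of "{1..n}" "\<lambda>_. 1" "\<lambda>j. cosh (a * y j)"] by (simp add: V_def cosh_real_ge_1)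

lemma V_nonneg: "0 \<le> V a" using V_ge_n[of a] by simp

text \<open>Second-order expansion in each bin: the linear part averages to the bias, and the
  quadratic part costs a relative growth of \<open>12 * a^2 / n\<close>.\<close>

lemma mean_V':
  assumes a: "0 \<le> a" "2 * a \<le> 1"
  shows "(\<Sum>i\<in>{1..n}. q i * V' a i) \<le> V a + a * (\<Sum>j\<in>{1..n}. b j * sinh (a * y j)) + 12 * a\<^sup>2 / n * V a"
proof -
  have c: "cosh (a * (y j + d i j)) \<le> cosh (a * y j) + (a * sinh (a * y j)) * d i j + a\<^sup>2 * cosh (a * y j) * (d i j)\<^sup>2"
    if "i \<in> {1..n}" for i j
  proof -
    have "\<bar>a * d i j\<bar> \<le> a * 2" using a abs_d_le[OF that] by (simp add: abs_mult mult_left_mono)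
    then have "cosh (a * y j + a * d i j) \<le> cosh (a * y j) * (1 + (a * d i j)\<^sup>2) + sinh (a * y j) * (a * d i j)"
      using a by (intro cosh_add_le) auto
    then show ?thesis by (simp add: algebra_simps power_mult_distrib)
  qed
  have "(\<Sum>i\<in>{1..n}. q i * V' a i) \<le> (\<Sum>i\<in>{1..n}. q i * (\<Sum>j\<in>{1..n}. cosh (a * y j)
      + (a * sinh (a * y j)) * d i j + a\<^sup>2 * cosh (a * y j) * (d i j)\<^sup>2))"
    unfolding V'_def using q_nonneg c by (intro sum_mono mult_left_mono) auto
  also have "\<dots> = (\<Sum>i\<in>{1..n}. q i) * V a
      + (\<Sum>i\<in>{1..n}. q i * (\<Sum>j\<in>{1..n}. (a * sinh (a * y j)) * d i j))
      + (\<Sum>i\<in>{1..n}. q i * (\<Sum>j\<in>{1..n}. a\<^sup>2 * cosh (a * y j) * (d i j)\<^sup>2))"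
    unfolding V_def sum.distrib distrib_left by (simp add: sum_distrib_right)
  also have "(\<Sum>i\<in>{1..n}. q i * (\<Sum>j\<in>{1..n}. a\<^sup>2 * cosh (a * y j) * (d i j)\<^sup>2))
      = (\<Sum>j\<in>{1..n}. a\<^sup>2 * cosh (a * y j) * (\<Sum>i\<in>{1..n}. q i * (d i j)\<^sup>2))"
    unfolding sum_distrib_left by (subst sum.swap) (simp add: mult_ac)
  also have "\<dots> \<le> (\<Sum>j\<in>{1..n}. a\<^sup>2 * cosh (a * y j) * (12 / n))"
    using mean_d_square by (intro sum_mono mult_left_mono) auto
  also have "\<dots> = 12 * a\<^sup>2 / n * V a"
    by (simp add: V_def sum_distrib_left mult_ac sum_divide_distrib)
  also have "(\<Sum>i\<in>{1..n}. q i * (\<Sum>j\<in>{1..n}. (a * sinh (a * y j)) * d i j)) = a * (\<Sum>j\<in>{1..n}. b j * sinh (a * y j))"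
    unfolding mean_sum_d by (simp add: sum_distrib_left mult_ac)
  finally show ?thesis by (simp add: sum_q)
qed

lemma V_le_sum_abs_sinh: "V a - n \<le> (\<Sum>j\<in>{1..n}. \<bar>sinh (a * y j)\<bar>)"
proof -
  have "V a - n = (\<Sum>j\<in>{1..n}. cosh (a * y j) - 1)" by (simp add: V_def sum_subtractf)
  also have "\<dots> \<le> (\<Sum>j\<in>{1..n}. \<bar>sinh (a * y j)\<bar>)" by (intro sum_mono cosh_le_abs_sinh)
  finally show ?thesis .
qed

text \<open>For this \<open>a\<close> the growth \<open>12 * a^2 / n\<close> is exactly half of the
  contraction rate \<open>a * \<beta> / n^2\<close> that comes from
  \<open>sum_b_sinh\<close>.\<close>

lemma mean_V'_coarse:
  assumes a: "a = \<beta> / (24 * n)"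
  shows "(\<Sum>i\<in>{1..n}. q i * V' a i) \<le> (1 - a * \<beta> / (2 * n\<^sup>2)) * V a + a * \<beta> / n"
proof -
  have a0: "0 \<le> a" "2 * a \<le> 1" using beta_pos beta_le_1 n_ge_2 by (auto simp: a divide_le_eq)
  have "(\<Sum>j\<in>{1..n}. b j * sinh (a * y j)) \<le> - (\<beta> / n\<^sup>2) * (\<Sum>j\<in>{1..n}. \<bar>sinh (a * y j)\<bar>)"
    using sum_b_sinh[OF a0(1)] .
  also have "\<dots> \<le> - (\<beta> / n\<^sup>2) * (V a - n)"
    using V_le_sum_abs_sinh beta_pos by (intro mult_left_mono_neg) auto
  finally have "a * (\<Sum>j\<in>{1..n}. b j * sinh (a * y j)) \<le> a * (- (\<beta> / n\<^sup>2) * (V a - n))"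
    using a0 by (intro mult_left_mono) auto
  then have "(\<Sum>i\<in>{1..n}. q i * V' a i) \<le> V a + a * (- (\<beta> / n\<^sup>2) * (V a - n)) + 12 * a\<^sup>2 / n * V a"
    using mean_V'[OF a0] by linarith
  also have "12 * a\<^sup>2 / n = a * \<beta> / (2 * n\<^sup>2)"
    using n_pos by (simp add: a power2_eq_square field_simps)
  also have "V a + a * (- (\<beta> / n\<^sup>2) * (V a - n)) + a * \<beta> / (2 * n\<^sup>2) * V a
      = (1 - a * \<beta> / (2 * n\<^sup>2)) * V a + a * \<beta> / n"
    using n_pos by (simp add: field_simps power2_eq_square)
  finally show ?thesis .
qed

end

text \<open>
  The bins within \<open>B\<close> of the mean lie in the concave part of the double well, \<open>Delta > D n\<close> is the regime
  where the quadratic part of the well dominates, \<open>s\<close> is the total bias that the well tolerates,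
  and \<open>T\<close> is the distance from the mean beyond which a bias of at least \<open>c/n\<close> is looked for.
\<close>

locale fine_step = biased_step +
  fixes B D s c T a R \<eta> :: real
  assumes B_eq: "B = 56 / \<beta> + 2"
    and D_eq: "\<beta> * D = 12 + 896 * B"
    and s_eq: "112 * B * s = 1"
    and c_eq: "c = s / 4"
    and T_eq: "s * T = 16 * D"
    and a_pos: "0 < a"
    and a_le: "4 * a \<le> 1" "48 * a \<le> c" "a * T \<le> 1" "26 * (6 + 448 * B) * a \<le> c" "56 * B * a \<le> 1"
      "128 * a \<le> \<beta>" "8 * (4 + 448 * B) * a \<le> 1"
    and y_le_R: "\<And>j. j \<in> {1..n} \<Longrightarrow> \<bar>y j\<bar> \<le> R"
    and eta_eq: "\<eta> = 13 * a\<^sup>2 / n * (4 * R + 4 + 448 * B)"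
    and eta_le: "\<eta> \<le> 1" "64 * \<eta> \<le> \<beta>" "4 * (4 + 448 * B) * \<eta> \<le> 1"
begin

text \<open>Near 0 this is \<open>- 55 * u^2\<close> plus a constant; the two minima are at distance
  \<open>56 * B\<close> from 0. By \<open>huber_le\<close> it is at least
  \<open>(|u| - 56 * B)^2\<close>, so the constant makes it nonnegative.\<close>

definition g :: "real \<Rightarrow> real" where "g u = u\<^sup>2 - 56 * huber B u + (56 * B)\<^sup>2"
text \<open>The factor 13 is 12 + 1: a drift of \<open>- lam\<close> in the exponent pays for the
  growth \<open>12 * a^2 / n\<close> of \<open>V\<close> and leaves a contraction by
  \<open>a^2 / n\<close>.\<close>

definition lam :: real where "lam = 13 * a\<^sup>2 / n"
definition Q :: real where "Q = lam * (\<Sum>j\<in>{1..n}. g (y j))"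
definition Q' :: "nat \<Rightarrow> real" where "Q' i = lam * (\<Sum>j\<in>{1..n}. g (y j + d i j))"
definition xi :: "nat \<Rightarrow> real" where "xi i = Q' i - Q"
definition Delta :: real where "Delta = (\<Sum>j\<in>{1..n}. \<bar>y j\<bar>)"
definition N :: real where
  "N = (\<Sum>i\<in>{1..n}. q i * (\<Sum>j | j \<in> {1..n} \<and> \<bar>y j\<bar> \<le> B - 2. (d i j)\<^sup>2))"

lemma B_pos: "0 < B" using beta_pos by (simp add: B_eq add_pos_pos)

lemma s_pos: "0 < s"
proof -
  have "0 < 112 * B * s" using s_eq by simp
  then show ?thesis using B_pos by (simp add: zero_less_mult_iff)
qed

lemma c_pos: "0 < c" using s_pos c_eq by simp

lemma D_pos: "0 < D"
proof -
  have "0 < \<beta> * D" using D_eq B_pos by simp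
  then show ?thesis using beta_pos by (simp add: zero_less_mult_iff)
qed

lemma T_pos: "0 < T"
proof -
  have "0 < s * T" using T_eq D_pos by simp
  then show ?thesis using s_pos by (simp add: zero_less_mult_iff)
qed

lemma lam_pos: "0 < lam" using a_pos n_pos by (simp add: lam_def)

lemma Delta_nonneg: "0 \<le> Delta" by (simp add: Delta_def sum_nonneg)

section \<open>Change of the double well in one round\<close>

lemma sum_d: "i \<in> {1..n} \<Longrightarrow> (\<Sum>j\<in>{1..n}. d i j) = 0"
  using sum_c_d[of i "\<lambda>_. 1"] n_pos by simp

text \<open>Take the changes themselves as coefficients in \<open>sum_c_d\<close>; since they sum to
  0, the sum of squares collapses to \<open>w i * d i i\<close>.\<close>

lemma sum_d_square:
  assumes "i \<in> {1..n}"
  shows "(\<Sum>j\<in>{1..n}. (d i j)\<^sup>2) \<le> 4"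
proof -
  have "(\<Sum>j\<in>{1..n}. (d i j)\<^sup>2) = w i * d i i"
    using sum_c_d[OF assms, of "d i"] sum_d[OF assms] by (simp add: power2_eq_square)
  also have "\<dots> \<le> 2 * 2"
    using w_ge_1[OF assms] w_le_2[OF assms] abs_d_le[OF assms, of i] w_div_n[OF assms]
    by (intro mult_mono) (simp_all add: abs_le_iff, simp add: d_def)
  finally show ?thesis by simp
qed

lemma sum_abs_d:
  assumes "i \<in> {1..n}"
  shows "(\<Sum>j\<in>{1..n}. \<bar>d i j\<bar>) \<le> 4"
proof -
  have "(\<Sum>j\<in>{1..n}. \<bar>d i j\<bar>) \<le> (\<Sum>j\<in>{1..n}. (if i = j then w i else 0) + w i / n)"
    using w_ge_1[OF assms] w_div_n[OF assms] unfolding d_def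
    by (intro sum_mono order_trans[OF abs_triangle_ineq4]) auto
  also have "\<dots> = 2 * w i" using assms n_pos by (simp add: sum.distrib)
  finally show ?thesis using w_le_2[OF assms] by simp
qed

lemma xi_eq:
  assumes "i \<in> {1..n}"
  shows "xi i = lam * (2 * (\<Sum>j\<in>{1..n}. y j * d i j) + (\<Sum>j\<in>{1..n}. (d i j)\<^sup>2)
    - 56 * (\<Sum>j\<in>{1..n}. huber B (y j + d i j) - huber B (y j)))"
proof -
  have "xi i = lam * (\<Sum>j\<in>{1..n}. g (y j + d i j) - g (y j))"
    by (simp add: xi_def Q_def Q'_def right_diff_distrib sum_subtractf)
  also have "(\<Sum>j\<in>{1..n}. g (y j + d i j) - g (y j))
     = (\<Sum>j\<in>{1..n}. 2 * (y j * d i j) + (d i j)\<^sup>2 - 56 * (huber B (y j + d i j) - huber B (y j)))"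
    by (intro sum.cong) (auto simp: g_def power2_eq_square algebra_simps)
  finally show ?thesis by (simp add: sum.distrib sum_subtractf sum_distrib_left)
qed

text \<open>As the deviations sum to 0, the linear term of the square is \<open>w i * y i\<close>,
  so only the receiving bin enters. Keeping \<open>y i\<close> yields \<open>Delta\<close> after
  averaging and \<open>R\<close> in the uniform bound.\<close>

lemma abs_xi_le:
  assumes i: "i \<in> {1..n}"
  shows "\<bar>xi i\<bar> \<le> lam * (4 * \<bar>y i\<bar> + 4 + 448 * B)"
proof -
  have "(\<Sum>j\<in>{1..n}. y j * d i j) = w i * y i"
    using sum_c_d[OF i, of y] sum_y by simp
  moreover have "\<bar>w i * y i\<bar> \<le> 2 * \<bar>y i\<bar>"
    using w_ge_1[OF i] w_le_2[OF i] unfolding abs_mult by (intro mult_right_mono) auto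
  moreover have "0 \<le> (\<Sum>j\<in>{1..n}. (d i j)\<^sup>2)" by (simp add: sum_nonneg)
  moreover have "\<bar>\<Sum>j\<in>{1..n}. huber B (y j + d i j) - huber B (y j)\<bar> \<le> 8 * B"
  proof -
    have "\<bar>\<Sum>j\<in>{1..n}. huber B (y j + d i j) - huber B (y j)\<bar> \<le> (\<Sum>j\<in>{1..n}. 2 * B * \<bar>d i j\<bar>)"
      using B_pos huber_lipschitz by (intro order_trans[OF sum_abs] sum_mono) auto
    also have "\<dots> \<le> 2 * B * 4" unfolding sum_distrib_left[symmetric]
      using B_pos sum_abs_d[OF i] by (intro mult_left_mono) auto
    finally show ?thesis by simp
  qed
  ultimately have "\<bar>2 * (\<Sum>j\<in>{1..n}. y j * d i j) + (\<Sum>j\<in>{1..n}. (d i j)\<^sup>2)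
    - 56 * (\<Sum>j\<in>{1..n}. huber B (y j + d i j) - huber B (y j))\<bar> \<le> 4 * \<bar>y i\<bar> + 4 + 448 * B"
    using sum_d_square[OF i] by linarith
  then show ?thesis using lam_pos unfolding xi_eq[OF i] abs_mult by (simp add: mult_left_mono)
qed

lemma abs_xi_le_eta:
  assumes i: "i \<in> {1..n}"
  shows "\<bar>xi i\<bar> \<le> \<eta>"
proof -
  have "lam * (4 * \<bar>y i\<bar> + 4 + 448 * B) \<le> lam * (4 * R + 4 + 448 * B)"
    using y_le_R[OF i] lam_pos by (intro mult_left_mono) auto
  then show ?thesis using abs_xi_le[OF i] by (simp add: eta_eq lam_def)
qed

lemma eta_nonneg: "0 \<le> \<eta>"
  using abs_xi_le_eta[of 1] n_ge_2 by (simp add: order_trans[OF abs_ge_zero])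

lemma mean_abs_xi: "(\<Sum>i\<in>{1..n}. q i * \<bar>xi i\<bar>) \<le> lam * (8 / n * Delta + (4 + 448 * B))"
proof -
  have "(\<Sum>i\<in>{1..n}. q i * \<bar>xi i\<bar>) \<le> (\<Sum>i\<in>{1..n}. q i * (lam * (4 * \<bar>y i\<bar> + (4 + 448 * B))))"
    using q_nonneg abs_xi_le by (intro sum_mono mult_left_mono) (auto simp: add.assoc)
  also have "\<dots> = (\<Sum>i\<in>{1..n}. lam * 4 * (q i * \<bar>y i\<bar>)) + (\<Sum>i\<in>{1..n}. q i) * (lam * (4 + 448 * B))"
    unfolding sum_distrib_right sum.distrib[symmetric] by (intro sum.cong) (auto simp: algebra_simps)
  also have "(\<Sum>i\<in>{1..n}. lam * 4 * (q i * \<bar>y i\<bar>)) \<le> (\<Sum>i\<in>{1..n}. lam * 4 * (2 / n * \<bar>y i\<bar>))"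
    using q_le lam_pos by (intro sum_mono mult_left_mono mult_right_mono) auto
  also have "\<dots> = lam * (8 / n * Delta)" by (simp add: Delta_def sum_distrib_left sum_divide_distrib mult_ac)
  finally show ?thesis by (simp add: sum_q distrib_left)
qed

text \<open>Convexity gives the tangent bound in every bin; a bin within \<open>B - 2\<close> of the
  mean contributes its full squared change on top.\<close>

lemma huber_sum_ge:
  assumes i: "i \<in> {1..n}"
  shows "2 * (\<Sum>j\<in>{1..n}. clip B (y j) * d i j) + (\<Sum>j | j \<in> {1..n} \<and> \<bar>y j\<bar> \<le> B - 2. (d i j)\<^sup>2)
    \<le> (\<Sum>j\<in>{1..n}. huber B (y j + d i j) - huber B (y j))"
proof -
  have "(\<Sum>j | j \<in> {1..n} \<and> \<bar>y j\<bar> \<le> B - 2. (d i j)\<^sup>2)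
      = (\<Sum>j\<in>{1..n}. if \<bar>y j\<bar> \<le> B - 2 then (d i j)\<^sup>2 else 0)"
    by (subst sum.inter_filter[symmetric]) auto
  then have "2 * (\<Sum>j\<in>{1..n}. clip B (y j) * d i j) + (\<Sum>j | j \<in> {1..n} \<and> \<bar>y j\<bar> \<le> B - 2. (d i j)\<^sup>2)
     = (\<Sum>j\<in>{1..n}. 2 * (clip B (y j) * d i j) + (if \<bar>y j\<bar> \<le> B - 2 then (d i j)\<^sup>2 else 0))"
    by (simp add: sum.distrib sum_distrib_left)
  also have "\<dots> \<le> (\<Sum>j\<in>{1..n}. huber B (y j + d i j) - huber B (y j))"
  proof (intro sum_mono)
    fix j
    show "2 * (clip B (y j) * d i j) + (if \<bar>y j\<bar> \<le> B - 2 then (d i j)\<^sup>2 else 0) \<le> huber B (y j + d i j) - huber B (y j)"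
      using huber_inner[of "y j" B "d i j"] abs_d_le[OF i, of j] huber_ge_tangent[of B "y j" "d i j"] B_pos
      by (auto simp: mult.assoc)
  qed
  finally show ?thesis .
qed

text \<open>The square drifts by \<open>sum_b_y\<close> and costs at most 4 at second order.
  Subtracting 56 times the Huber function turns its convexity into the gain \<open>56 * N\<close>,
  at the price of the \<open>clip\<close> term, which is at most \<open>112 * B\<close> times the
  total absolute bias.\<close>

lemma mean_xi:
  "(\<Sum>i\<in>{1..n}. q i * xi i)
     \<le> lam * (- (\<beta> / n) * Delta + 4 - 112 * (\<Sum>j\<in>{1..n}. clip B (y j) * b j) - 56 * N)"
proof -
  have "(\<Sum>i\<in>{1..n}. q i * xi i) \<le> (\<Sum>i\<in>{1..n}. q i * (lam * (2 * (\<Sum>j\<in>{1..n}. y j * d i j) + 4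
    - 56 * (2 * (\<Sum>j\<in>{1..n}. clip B (y j) * d i j) + (\<Sum>j | j \<in> {1..n} \<and> \<bar>y j\<bar> \<le> B - 2. (d i j)\<^sup>2)))))"
  proof (intro sum_mono mult_left_mono q_nonneg)
    fix i assume i: "i \<in> {1..n}"
    show "xi i \<le> lam * (2 * (\<Sum>j\<in>{1..n}. y j * d i j) + 4
    - 56 * (2 * (\<Sum>j\<in>{1..n}. clip B (y j) * d i j) + (\<Sum>j | j \<in> {1..n} \<and> \<bar>y j\<bar> \<le> B - 2. (d i j)\<^sup>2)))"
      unfolding xi_eq[OF i] using lam_pos sum_d_square[OF i] huber_sum_ge[OF i]
      by (intro mult_left_mono) auto
  qed
  also have "\<dots> = lam * (\<Sum>i\<in>{1..n}. 2 * (q i * (\<Sum>j\<in>{1..n}. y j * d i j)) + 4 * q i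
    - (112 * (q i * (\<Sum>j\<in>{1..n}. clip B (y j) * d i j)) + 56 * (q i * (\<Sum>j | j \<in> {1..n} \<and> \<bar>y j\<bar> \<le> B - 2. (d i j)\<^sup>2))))"
    unfolding sum_distrib_left[of lam] by (intro sum.cong) (auto simp: algebra_simps)
  also have "\<dots> = lam * (2 * (\<Sum>j\<in>{1..n}. y j * b j) + 4
    - (112 * (\<Sum>j\<in>{1..n}. clip B (y j) * b j) + 56 * N))"
    unfolding sum.distrib sum_subtractf sum_distrib_left[symmetric] mean_sum_d sum_q N_def by simp
  also have "\<dots> \<le> lam * (- (\<beta> / n) * Delta + 4 - (112 * (\<Sum>j\<in>{1..n}. clip B (y j) * b j) + 56 * N))"
    using lam_pos sum_b_y by (intro mult_left_mono) (auto simp: Delta_def mult.commute)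
  finally show ?thesis by (simp add: algebra_simps)
qed

text \<open>This bounds the relative drift caused by the factor \<open>exp Q\<close>: the
  coefficient \<open>4 * a\<close> covers its interaction with the change of \<open>V\<close>, and
  \<open>2 * \<eta>\<close> the second-order term of the exponential.\<close>

definition X :: real where
  "X = (\<Sum>i\<in>{1..n}. q i * xi i) + (4 * a + 2 * \<eta>) * (\<Sum>i\<in>{1..n}. q i * \<bar>xi i\<bar>)"

text \<open>Half of the drift in \<open>Delta\<close> and one additional unit (4 becomes 5) absorb
  the correction terms of \<open>X\<close>.\<close>

lemma X_le: "X \<le> lam * (- (\<beta> / (2 * n)) * Delta + 5 - 112 * (\<Sum>j\<in>{1..n}. clip B (y j) * b j) - 56 * N)"
proof -
  have t0: "0 \<le> 4 * a + 2 * \<eta>" using a_pos eta_nonneg by simp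
  have "(4 * a + 2 * \<eta>) * (8 / n * Delta) \<le> (\<beta> / 16) * (8 / n * Delta)"
    using a_le eta_le Delta_nonneg by (intro mult_right_mono) auto
  moreover have "(\<beta> / 16) * (8 / n * Delta) = (\<beta> / (2 * n)) * Delta" by simp
  moreover have "(4 * a + 2 * \<eta>) * (4 + 448 * B) \<le> 1" using a_le eta_le by (simp add: algebra_simps)
  ultimately have "(4 * a + 2 * \<eta>) * (8 / n * Delta + (4 + 448 * B)) \<le> (\<beta> / (2 * n)) * Delta + 1"
    by (simp only: distrib_left)
  then have "lam * ((4 * a + 2 * \<eta>) * (8 / n * Delta + (4 + 448 * B))) \<le> lam * ((\<beta> / (2 * n)) * Delta + 1)"
    using lam_pos by (intro mult_left_mono) auto
  moreover have "(4 * a + 2 * \<eta>) * (\<Sum>i\<in>{1..n}. q i * \<bar>xi i\<bar>)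
     \<le> lam * ((4 * a + 2 * \<eta>) * (8 / n * Delta + (4 + 448 * B)))"
    using mult_left_mono[OF mean_abs_xi t0] by (simp only: mult_ac)
  ultimately have "X \<le> lam * (- (\<beta> / n) * Delta + 4 - 112 * (\<Sum>j\<in>{1..n}. clip B (y j) * b j) - 56 * N)
      + lam * ((\<beta> / (2 * n)) * Delta + 1)"
    unfolding X_def using mean_xi by linarith
  also have "\<dots> = lam * (- (\<beta> / (2 * n)) * Delta + 5 - 112 * (\<Sum>j\<in>{1..n}. clip B (y j) * b j) - 56 * N)"
  proof -
    have "\<beta> / n * Delta = 2 * (\<beta> / (2 * n) * Delta)" by simp
    then show ?thesis unfolding distrib_left[symmetric] by (intro arg_cong2[where f = "(*)"] refl) linarith
  qed
  finally show ?thesis .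
qed

lemma V'_V:
  assumes i: "i \<in> {1..n}"
  shows "\<bar>V' a i - V a\<bar> \<le> 4 * a * V a"
proof -
  have "\<bar>V' a i - V a\<bar> \<le> (\<Sum>j\<in>{1..n}. \<bar>cosh (a * (y j + d i j)) - cosh (a * y j)\<bar>)"
    unfolding V'_def V_def sum_subtractf[symmetric] by (rule sum_abs)
  also have "\<dots> \<le> (\<Sum>j\<in>{1..n}. 4 * a * cosh (a * y j))"
  proof (intro sum_mono)
    fix j
    have s: "\<bar>a * d i j\<bar> \<le> 2 * a" using a_pos abs_d_le[OF i, of j] by (simp add: abs_mult)
    have "\<bar>cosh (a * y j + a * d i j) - cosh (a * y j)\<bar> \<le> 2 * \<bar>a * d i j\<bar> * cosh (a * y j)"
      using s a_le by (intro cosh_add_diff_le) auto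
    also have "\<dots> \<le> 4 * a * cosh (a * y j)" using s by (intro mult_right_mono) auto
    finally show "\<bar>cosh (a * (y j + d i j)) - cosh (a * y j)\<bar> \<le> 4 * a * cosh (a * y j)"
      by (simp add: distrib_left)
  qed
  finally show ?thesis by (simp add: V_def sum_distrib_left)
qed

lemma V'_le: "i \<in> {1..n} \<Longrightarrow> V' a i \<le> 2 * V a"
proof -
  assume "i \<in> {1..n}"
  moreover have "4 * a * V a \<le> 1 * V a" using a_le V_nonneg by (intro mult_right_mono) auto
  ultimately show ?thesis using V'_V by fastforce
qed

lemma V'_nonneg: "0 \<le> V' a i" by (simp add: V'_def sum_nonneg)

text \<open>Factor \<open>exp (Q' i)\<close> as \<open>exp Q * exp (xi i)\<close> and expand the
  second factor to second order. In the linear term \<open>V' a i\<close> is replaced by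
  \<open>V a\<close> by means of \<open>V'_V\<close>; in the quadratic term one factor
  \<open>|xi i|\<close> is bounded by \<open>\<eta>\<close>.\<close>

lemma mean_potential:
  "(\<Sum>i\<in>{1..n}. q i * (V' a i * exp (Q' i))) \<le> exp Q * ((\<Sum>i\<in>{1..n}. q i * V' a i) + V a * X)"
proof -
  have le: "V' a i * exp (Q' i) \<le> exp Q * (V' a i + V a * xi i + V a * (4 * a + 2 * \<eta>) * \<bar>xi i\<bar>)"
    if i: "i \<in> {1..n}" for i
  proof -
    have "\<bar>xi i\<bar> \<le> 1" using abs_xi_le_eta[OF i] eta_le by simp
    then have "V' a i * exp (xi i) \<le> V' a i * (1 + xi i + (xi i)\<^sup>2)"
      by (intro mult_left_mono exp_le_quadratic V'_nonneg)
    also have "\<dots> = V' a i + V a * xi i + (V' a i - V a) * xi i + V' a i * (xi i)\<^sup>2"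
      by (simp add: algebra_simps)
    also have "(V' a i - V a) * xi i \<le> 4 * a * V a * \<bar>xi i\<bar>"
    proof -
      have "(V' a i - V a) * xi i \<le> \<bar>V' a i - V a\<bar> * \<bar>xi i\<bar>"
        unfolding abs_mult[symmetric] by (rule abs_ge_self)
      also have "\<dots> \<le> 4 * a * V a * \<bar>xi i\<bar>" by (intro mult_right_mono V'_V i) auto
      finally show ?thesis .
    qed
    also have "V' a i * (xi i)\<^sup>2 \<le> (2 * V a) * (\<eta> * \<bar>xi i\<bar>)"
    proof (intro mult_mono V'_le i)
      have "\<bar>xi i\<bar> * \<bar>xi i\<bar> \<le> \<eta> * \<bar>xi i\<bar>" using abs_xi_le_eta[OF i] by (intro mult_right_mono) auto
      then show "(xi i)\<^sup>2 \<le> \<eta> * \<bar>xi i\<bar>" by (simp add: power2_eq_square)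
    qed (use V_nonneg in auto)
    finally have "V' a i * exp (xi i) \<le> V' a i + V a * xi i + V a * (4 * a + 2 * \<eta>) * \<bar>xi i\<bar>"
      by (simp add: algebra_simps)
    then have "exp Q * (V' a i * exp (xi i)) \<le> exp Q * (V' a i + V a * xi i + V a * (4 * a + 2 * \<eta>) * \<bar>xi i\<bar>)"
      by simp
    moreover have "exp Q * exp (xi i) = exp (Q' i)" by (simp add: mult_exp_exp xi_def)
    ultimately show ?thesis by (simp add: mult_ac)
  qed
  have "(\<Sum>i\<in>{1..n}. q i * (V' a i * exp (Q' i)))
     \<le> (\<Sum>i\<in>{1..n}. q i * (exp Q * (V' a i + V a * xi i + V a * (4 * a + 2 * \<eta>) * \<bar>xi i\<bar>)))"
    by (intro sum_mono mult_left_mono le q_nonneg)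
  also have "\<dots> = exp Q * (\<Sum>i\<in>{1..n}. q i * V' a i + V a * (q i * xi i) + V a * (4 * a + 2 * \<eta>) * (q i * \<bar>xi i\<bar>))"
    unfolding sum_distrib_left[of "exp Q"] by (intro sum.cong) (auto simp: algebra_simps)
  also have "\<dots> = exp Q * ((\<Sum>i\<in>{1..n}. q i * V' a i) + V a * X)"
    unfolding sum.distrib sum_distrib_left[symmetric] X_def by (simp add: algebra_simps)
  finally show ?thesis .
qed

section \<open>Regimes of the total deviation and the total bias\<close>

lemma N_nonneg: "0 \<le> N"
  unfolding N_def using q_nonneg by (intro sum_nonneg mult_nonneg_nonneg) auto

lemma card_abs_gt:
  assumes "0 < t"
  shows "t * card {j \<in> {1..n}. t < \<bar>y j\<bar>} \<le> Delta"
proof -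
  have "t * card {j \<in> {1..n}. t < \<bar>y j\<bar>} = (\<Sum>j\<in>{j \<in> {1..n}. t < \<bar>y j\<bar>}. t)" by simp
  also have "\<dots> \<le> (\<Sum>j\<in>{j \<in> {1..n}. t < \<bar>y j\<bar>}. \<bar>y j\<bar>)" by (intro sum_mono) auto
  also have "\<dots> \<le> Delta" unfolding Delta_def by (intro sum_mono2) auto
  finally show ?thesis .
qed

text \<open>As \<open>\<beta> * (B - 2) = 56\<close>, Markov's inequality leaves at most a quarter
  of the bins farther than \<open>B - 2\<close> from the mean. Hence with probability at least 1/2 a
  near bin receives the balls, and its own squared change is at least 1/4.\<close>

lemma N_ge:
  assumes small: "\<beta> * Delta < 14 * n"
  shows "1 / 8 \<le> N"
proof -
  let ?J = "{j \<in> {1..n}. \<bar>y j\<bar> \<le> B - 2}"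
  let ?K = "{j \<in> {1..n}. B - 2 < \<bar>y j\<bar>}"
  have B2: "0 < B - 2" "\<beta> * (B - 2) = 56" using beta_pos by (auto simp: B_eq)
  have "56 * real (card ?K) = \<beta> * ((B - 2) * card ?K)" unfolding B2(2)[symmetric] by simp
  also have "\<dots> \<le> \<beta> * Delta" using card_abs_gt[OF B2(1)] beta_pos by simp
  finally have cK: "4 * real (card ?K) \<le> n" using small by linarith
  have dd: "1 / 4 \<le> (d j j)\<^sup>2" if "j \<in> {1..n}" for j
  proof -
    have "w j / n \<le> w j / 2" using n_ge_2 w_ge_1[OF that] by (intro divide_left_mono) auto
    then have "1 / 2 \<le> d j j" using w_ge_1[OF that] by (simp add: d_def)
    then have "(1 / 2)\<^sup>2 \<le> (d j j)\<^sup>2" by (intro power_mono) auto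
    then show ?thesis by (simp add: power2_eq_square)
  qed
  have "(\<Sum>j\<in>?K. q j) \<le> (\<Sum>j\<in>?K. 2 / n)" using q_le by (intro sum_mono) auto
  also have "\<dots> = 2 * real (card ?K) / n" by simp
  also have "\<dots> \<le> 1 / 2" using cK n_pos by (simp add: divide_le_eq)
  finally have K: "(\<Sum>j\<in>?K. q j) \<le> 1 / 2" .
  have "1 = (\<Sum>j\<in>?J \<union> ?K. q j)"
  proof -
    have "?J \<union> ?K = {1..n}" by auto
    then show ?thesis by (simp only: sum_q)
  qed
  also have "\<dots> = (\<Sum>j\<in>?J. q j) + (\<Sum>j\<in>?K. q j)" by (intro sum.union_disjoint) auto
  finally have "1 / 2 \<le> (\<Sum>j\<in>?J. q j)" using K by simp
  then have "1 / 8 \<le> (\<Sum>j\<in>?J. q j * (1 / 4))" unfolding sum_distrib_right[symmetric] by simp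
  also have "\<dots> \<le> (\<Sum>i\<in>?J. q i * (\<Sum>j\<in>?J. (d i j)\<^sup>2))"
  proof (intro sum_mono mult_left_mono)
    fix i assume i: "i \<in> ?J"
    have "(d i i)\<^sup>2 \<le> (\<Sum>j\<in>?J. (d i j)\<^sup>2)" using i by (intro member_le_sum) auto
    then show "1 / 4 \<le> (\<Sum>j\<in>?J. (d i j)\<^sup>2)" using dd[of i] i by auto
  qed (use q_nonneg in auto)
  also have "\<dots> \<le> N" unfolding N_def
    using q_nonneg by (intro sum_mono2) (auto intro!: mult_nonneg_nonneg sum_nonneg)
  finally show ?thesis .
qed

lemma sum_clip_b: "- (\<Sum>j\<in>{1..n}. clip B (y j) * b j) \<le> B * (\<Sum>j\<in>{1..n}. \<bar>b j\<bar>)"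
proof -
  have "- (\<Sum>j\<in>{1..n}. clip B (y j) * b j) \<le> (\<Sum>j\<in>{1..n}. \<bar>clip B (y j) * b j\<bar>)"
    unfolding sum_negf[symmetric] by (intro sum_mono) auto
  also have "\<dots> \<le> (\<Sum>j\<in>{1..n}. B * \<bar>b j\<bar>)"
    unfolding abs_mult using B_pos abs_clip_le by (intro sum_mono mult_right_mono) auto
  finally show ?thesis by (simp add: sum_distrib_left)
qed

text \<open>Bin \<open>k\<close> is far out on side \<open>e\<close> but not pushed back at rate
  \<open>c/n\<close>. By monotonicity no bin less extreme than \<open>k\<close> has
  \<open>e * b j\<close> below \<open>- c / n\<close>, and the remaining bins are few by Markov's
  inequality. Since the biases sum to 0, their absolute values sum to twice the negative
  parts.\<close>

lemma sum_abs_b_le: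
  assumes e: "e = 1 \<or> e = - 1"
    and k: "k \<in> {1..n}" "T < e * y k" "- c / n < e * b k"
    and small: "Delta \<le> D * n"
  shows "(\<Sum>j\<in>{1..n}. \<bar>b j\<bar>) \<le> s"
proof -
  let ?K = "{j \<in> {1..n}. T < \<bar>y j\<bar>}"
  have eq: "\<bar>b j\<bar> = e * b j + 2 * max 0 (- (e * b j))" for j using e by auto
  have le: "max 0 (- (e * b j)) \<le> c / n + (if j \<in> ?K then 4 / n else 0)" if j: "j \<in> {1..n}" for j
  proof (cases "e * y j < e * y k")
    case True
    then have "e * b k \<le> e * b j" using e b_mono[OF j k(1)] b_mono[OF k(1) j] by auto
    then have "- (e * b j) \<le> c / n" using k(3) by simp
    moreover have "0 \<le> c / n" "0 \<le> 4 / real n" using c_pos by auto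
    ultimately show ?thesis by (simp only: if_True if_False max.bounded_iff split: if_split) linarith
  next
    case False
    then have "j \<in> ?K" using k(2) e j by auto
    moreover have "- (e * b j) \<le> 4 / n" using e b_bounds[OF j] by auto
    moreover have "0 \<le> c / n" "0 \<le> 4 / real n" using c_pos by auto
    ultimately show ?thesis by (simp only: if_True if_False max.bounded_iff split: if_split) linarith
  qed
  have "(\<Sum>j\<in>{1..n}. \<bar>b j\<bar>) = e * (\<Sum>j\<in>{1..n}. b j) + 2 * (\<Sum>j\<in>{1..n}. max 0 (- (e * b j)))"
    unfolding sum_distrib_left sum.distrib[symmetric] eq ..
  also have "\<dots> = 2 * (\<Sum>j\<in>{1..n}. max 0 (- (e * b j)))" by (simp add: sum_b)
  also have "\<dots> \<le> 2 * (\<Sum>j\<in>{1..n}. c / n + (if j \<in> ?K then 4 / n else 0))"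
    using le by (intro mult_left_mono sum_mono) auto
  also have "(\<Sum>j\<in>{1..n}. c / n + (if j \<in> ?K then 4 / n else 0)) = c + card ?K * (4 / n)"
    using n_pos by (simp add: sum.distrib sum.If_cases Int_def)
  \<comment> \<open>\<open>s * T = 16 * D\<close> leaves at most \<open>s * n / 16\<close> bins
    beyond \<open>T\<close>.\<close>
  also have "card ?K * (4 / n) \<le> s / 4"
  proof -
    have "16 * D * card ?K = s * (T * card ?K)" using T_eq by (simp add: mult.assoc[symmetric])
    also have "\<dots> \<le> s * (D * n)" using card_abs_gt[OF T_pos] small s_pos by (intro mult_left_mono) auto
    finally have "D * (16 * card ?K) \<le> D * (s * n)" by (simp add: mult_ac)
    then have "16 * card ?K \<le> s * n" using D_pos by simp
    then show ?thesis using n_pos by (simp add: divide_le_eq)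
  qed
  finally show ?thesis by (simp add: c_eq)
qed

text \<open>Bins beyond \<open>T\<close> are pushed back at rate \<open>c/n\<close>, and
  \<open>a * T \<le> 1\<close> keeps the sinh of the others at most 2 in absolute value. The
  constant 11 consists of 8 from \<open>sum_abs_b\<close> and \<open>3 * c\<close> from the offset 2
  and the passage from sinh to cosh.\<close>

lemma contraction:
  assumes over: "\<And>j. j \<in> {1..n} \<Longrightarrow> T < y j \<Longrightarrow> b j \<le> - c / n"
    and under: "\<And>j. j \<in> {1..n} \<Longrightarrow> y j < - T \<Longrightarrow> c / n \<le> b j"
    and c1: "c \<le> 1"
  shows "(\<Sum>j\<in>{1..n}. b j * sinh (a * y j)) \<le> - (c / n) * V a + 11"
proof -
  have "b j * sinh (a * y j) \<le> - (c / n) * (\<bar>sinh (a * y j)\<bar> - 2) + \<bar>b j\<bar> * 2" if j: "j \<in> {1..n}" for j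
  proof (cases "\<bar>y j\<bar> \<le> T")
    case True
    have "a * \<bar>y j\<bar> \<le> a * T" using True a_pos by (intro mult_left_mono) auto
    then have "a * \<bar>y j\<bar> \<le> 1" using a_le(3) by linarith
    then have "sinh \<bar>a * y j\<bar> \<le> 2" using a_pos by (intro sinh_le_2) (simp add: abs_mult)
    moreover have "sinh \<bar>a * y j\<bar> = \<bar>sinh (a * y j)\<bar>" by (cases "a * y j \<ge> 0") (auto simp: abs_if)
    ultimately have 2: "\<bar>sinh (a * y j)\<bar> \<le> 2" by simp
    then have "\<bar>b j * sinh (a * y j)\<bar> \<le> \<bar>b j\<bar> * 2" unfolding abs_mult by (intro mult_left_mono) auto
    moreover have "0 \<le> - (c / n) * (\<bar>sinh (a * y j)\<bar> - 2)"
      using 2 c_pos by (intro mult_nonpos_nonpos) auto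
    ultimately show ?thesis by linarith
  next
    case False
    have "b j * sinh (a * y j) \<le> - (c / n) * \<bar>sinh (a * y j)\<bar>"
    proof (cases "0 \<le> y j")
      case True
      then have "0 \<le> sinh (a * y j)" using a_pos by simp
      moreover have "b j \<le> - (c / n)" using over[OF j] False True by simp
      ultimately show ?thesis using mult_right_mono[of "b j" "- (c / n)" "sinh (a * y j)"] by simp
    next
      case neg: False
      then have "sinh (a * y j) \<le> 0" using a_pos by (simp add: mult_nonneg_nonpos)
      moreover have "c / n \<le> b j" using under[OF j] False neg by simp
      ultimately show ?thesis using mult_right_mono_neg[of "c / n" "b j" "sinh (a * y j)"] by simp
    qed
    moreover have "0 \<le> c / n" using c_pos by simp
    moreover have "- (c / n) * (\<bar>sinh (a * y j)\<bar> - 2) = - (c / n) * \<bar>sinh (a * y j)\<bar> + 2 * (c / n)"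
      by (simp only: right_diff_distrib) simp
    ultimately show ?thesis using abs_ge_zero[of "b j"] by linarith
  qed
  then have "(\<Sum>j\<in>{1..n}. b j * sinh (a * y j))
      \<le> (\<Sum>j\<in>{1..n}. - (c / n) * (\<bar>sinh (a * y j)\<bar> - 2) + \<bar>b j\<bar> * 2)"
    by (intro sum_mono)
  also have "\<dots> = - (c / n) * ((\<Sum>j\<in>{1..n}. \<bar>sinh (a * y j)\<bar>) - 2 * n) + (\<Sum>j\<in>{1..n}. \<bar>b j\<bar>) * 2"
    by (simp add: sum.distrib sum_subtractf sum_distrib_left[symmetric] sum_distrib_right[symmetric] sum_negf
        sum_divide_distrib[symmetric])
  also have "\<dots> \<le> - (c / n) * ((V a - n) - 2 * n) + 4 * 2"
    using V_le_sum_abs_sinh[of a] sum_abs_b c_pos by (intro add_mono mult_left_mono_neg mult_right_mono) auto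
  also have "\<dots> = - (c / n) * V a + 3 * c + 8" using n_pos by (simp add: field_simps)
  finally show ?thesis using c1 by simp
qed

lemma c_le_1: "c \<le> 1"
proof -
  have "1 * s \<le> 112 * B * s" using s_pos B_pos B_eq beta_pos by (intro mult_right_mono) auto
  then show ?thesis using s_eq c_eq by simp
qed

lemma mean_V'_le: "(\<Sum>i\<in>{1..n}. q i * V' a i) \<le> V a + 12 * a\<^sup>2 / n * V a"
proof -
  have "a * (\<Sum>j\<in>{1..n}. b j * sinh (a * y j)) \<le> 0"
    using a_pos sum_b_sinh_nonpos[of a] by (simp add: mult_nonneg_nonpos)
  then show ?thesis using mean_V'[of a] a_pos a_le by simp
qed

text \<open>In all cases but the last the exponent alone satisfies \<open>X \<le> - lam\<close>, and
  \<open>reduce\<close> applies. In the last case \<open>V\<close> contracts at a rate of order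
  \<open>a/n\<close>, which outweighs the possible growth of order \<open>a^2 / n\<close> from the
  exponent.\<close>

lemma drift_large:
  assumes large: "44 / c * n \<le> V a"
  shows "(\<Sum>i\<in>{1..n}. q i * (V' a i * exp (Q' i))) \<le> (1 - a\<^sup>2 / n) * (V a * exp Q)"
proof -
  let ?S = "\<Sum>j\<in>{1..n}. clip B (y j) * b j"
  let ?E = "\<Sum>i\<in>{1..n}. q i * V' a i"
  have S: "- ?S \<le> 4 * B"
  proof -
    have "B * (\<Sum>j\<in>{1..n}. \<bar>b j\<bar>) \<le> B * 4" using sum_abs_b B_pos by (intro mult_left_mono) auto
    then show ?thesis using sum_clip_b by simp
  qed
  have X_le': "X \<le> lam * u" if "- (\<beta> / (2 * n)) * Delta + 5 - 112 * ?S - 56 * N \<le> u" for u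
    using order_trans[OF X_le mult_left_mono[OF that, of lam]] lam_pos by simp
  have reduce: "?E + V a * X \<le> (1 - a\<^sup>2 / n) * V a" if "X \<le> - lam"
  proof -
    have "V a * X \<le> V a * - lam" using that V_nonneg by (intro mult_left_mono)
    then have "?E + V a * X \<le> V a + 12 * a\<^sup>2 / n * V a + V a * - lam" using mean_V'_le by linarith
    also have "\<dots> = (1 - a\<^sup>2 / n) * V a" by (simp add: lam_def algebra_simps)
    finally show ?thesis .
  qed
  have "?E + V a * X \<le> (1 - a\<^sup>2 / n) * V a"
  proof (cases "Delta \<le> D * n")
    case False
    then have "\<beta> / (2 * n) * (D * n) \<le> \<beta> / (2 * n) * Delta"
      using beta_pos n_pos by (intro mult_left_mono) auto
    moreover have "\<beta> / (2 * n) * (D * n) = (\<beta> * D) / 2" using n_pos by simp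
    \<comment> \<open>Half of \<open>\<beta> * D\<close> is \<open>6 + 448 * B\<close>, one more
      than the constant 5 together with the worst \<open>clip\<close> term
      \<open>112 * 4 * B\<close>.\<close>
    ultimately have "- (\<beta> / (2 * n)) * Delta + 5 - 112 * ?S - 56 * N \<le> - 1"
      using S N_nonneg D_eq by simp
    from X_le'[OF this] show ?thesis by (intro reduce) simp
  next
    case small: True
    show ?thesis
    proof (cases "(\<exists>k\<in>{1..n}. T < y k \<and> - c / n < b k) \<or> (\<exists>k\<in>{1..n}. y k < - T \<and> b k < c / n)")
      case True
      then obtain e k where ek: "e = (1::real) \<or> e = - 1" "k \<in> {1..n}" "T < e * y k" "- c / n < e * b k"
      proof (elim disjE bexE conjE)
        fix k assume "k \<in> {1..n}" "T < y k" "- c / n < b k"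
        then show thesis using that[of 1 k] by simp
      next
        fix k assume "k \<in> {1..n}" "y k < - T" "b k < c / n"
        then show thesis using that[of "- 1" k] by simp
      qed
      from sum_abs_b_le[OF ek small] have "B * (\<Sum>j\<in>{1..n}. \<bar>b j\<bar>) \<le> B * s"
        using B_pos by (intro mult_left_mono) auto
      then have S1: "- (112 * ?S) \<le> 1" using sum_clip_b s_eq by simp
      show ?thesis
      proof (cases "\<beta> * Delta < 14 * n")
        case True
        have "0 \<le> \<beta> / (2 * n) * Delta" using beta_pos Delta_nonneg by simp
        \<comment> \<open>Here \<open>56 * N \<ge> 7\<close> beats 5 + 1. In the complementary case
          the bound \<open>14 * n\<close> on \<open>\<beta> * Delta\<close> makes the drift in
          \<open>Delta\<close> supply the same 7.\<close>
        then have "- (\<beta> / (2 * n)) * Delta + 5 - 112 * ?S - 56 * N \<le> - 1"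
          using S1 N_ge[OF True] by simp
        from X_le'[OF this] show ?thesis by (intro reduce) simp
      next
        case False
        then have "7 \<le> \<beta> / (2 * n) * Delta" using n_pos by (simp add: le_divide_eq)
        then have "- (\<beta> / (2 * n)) * Delta + 5 - 112 * ?S - 56 * N \<le> - 1"
          using S1 N_nonneg by simp
        from X_le'[OF this] show ?thesis by (intro reduce) simp
      qed
    next
      case False
      then have "(\<Sum>j\<in>{1..n}. b j * sinh (a * y j)) \<le> - (c / n) * V a + 11"
        by (intro contraction c_le_1) (force simp: not_less)+
      then have "a * (\<Sum>j\<in>{1..n}. b j * sinh (a * y j)) \<le> a * (- (c / n) * V a + 11)"
        using a_pos by (intro mult_left_mono) auto
      then have E: "?E \<le> V a + a * (- (c / n) * V a + 11) + 12 * a\<^sup>2 / n * V a"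
        using mean_V'[of a] a_pos a_le by linarith
      have "0 \<le> \<beta> / (2 * n) * Delta" using beta_pos Delta_nonneg by simp
      then have "- (\<beta> / (2 * n)) * Delta + 5 - 112 * ?S - 56 * N \<le> 5 + 448 * B"
        using S N_nonneg by simp
      from X_le'[OF this] have VX: "V a * X \<le> V a * (lam * (5 + 448 * B))"
        using V_nonneg by (intro mult_left_mono) auto
      \<comment> \<open>The threshold \<open>44 / c * n\<close> is chosen so that the constant 11
        uses up a quarter of the contraction.\<close>
      have "11 \<le> c / (4 * n) * V a"
        using large c_pos n_pos by (simp add: field_simps)
      then have 11: "a * 11 \<le> a * (c / (4 * n) * V a)" using a_pos by (intro mult_left_mono) auto
      have combine: "\<lbrakk>E \<le> v + u + k; x \<le> x'; m \<le> m'; u = - p + m; r = v - p + m' + k + x'\<rbrakk> \<Longrightarrow> E + x \<le> r"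
        for E v u k x x' m m' p r :: real by linarith
      have "?E + V a * X \<le> V a * (1 - a * (c / n) + a * (c / (4 * n)) + 12 * a\<^sup>2 / n + lam * (5 + 448 * B))"
      proof (rule combine[OF E VX 11])
        show "a * (- (c / n) * V a + 11) = - (a * (c / n) * V a) + a * 11"
          by (simp add: distrib_left right_diff_distrib)
      qed (simp only: distrib_left right_diff_distrib, simp add: mult_ac)
      also have "\<dots> \<le> V a * (1 - a\<^sup>2 / n)"
      proof (intro mult_left_mono V_nonneg)
        \<comment> \<open>The other three quarters: \<open>48 * a \<le> c\<close> spends
          \<open>c / 4\<close> on the growth of \<open>V\<close>, and
          \<open>26 * (6 + 448 * B) * a \<le> c\<close> spends \<open>c / 2\<close> on the exponent
          and the final \<open>a^2 / n\<close>.\<close>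
        have "12 * a + 13 * (5 + 448 * B) * a + a \<le> c / 4 + c / 2" using a_le c_pos by (simp add: algebra_simps)
        then have "(a / n) * (12 * a + 13 * (5 + 448 * B) * a + a) \<le> (a / n) * (c / 4 + c / 2)"
          using a_pos by (intro mult_left_mono) auto
        moreover have "(a / n) * (12 * a + 13 * (5 + 448 * B) * a + a) = 12 * a\<^sup>2 / n + lam * (5 + 448 * B) + a\<^sup>2 / n"
          by (simp add: lam_def power2_eq_square distrib_left add_divide_distrib mult_ac)
        moreover have "(a / n) * (c / 4 + c / 2) = a * (c / n) - a * (c / (4 * n))"
          using n_pos by (simp add: field_simps)
        ultimately show "1 - a * (c / n) + a * (c / (4 * n)) + 12 * a\<^sup>2 / n + lam * (5 + 448 * B) \<le> 1 - a\<^sup>2 / n"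
          by linarith
      qed
      finally show ?thesis by (simp add: mult.commute)
    qed
  qed
  then have "exp Q * (?E + V a * X) \<le> exp Q * ((1 - a\<^sup>2 / n) * V a)" by (intro mult_left_mono) auto
  also have "\<dots> = (1 - a\<^sup>2 / n) * (V a * exp Q)" by (simp add: mult_ac)
  finally show ?thesis using mean_potential by linarith
qed

lemma sum_g_le: "(\<Sum>j\<in>{1..n}. g (y j)) \<le> 4 / a\<^sup>2 * V a + n * (56 * B)\<^sup>2"
proof -
  have "(\<Sum>j\<in>{1..n}. g (y j)) \<le> (\<Sum>j\<in>{1..n}. 4 / a\<^sup>2 * cosh (a * y j) + (56 * B)\<^sup>2)"
  proof (intro sum_mono)
    fix j
    have "(a * y j)\<^sup>2 / 4 \<le> cosh (a * y j)" by (rule cosh_ge_quadratic)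
    then have "(y j)\<^sup>2 \<le> 4 / a\<^sup>2 * cosh (a * y j)" using a_pos by (simp add: field_simps)
    moreover have "0 \<le> huber B (y j)" using B_pos huber_nonneg by simp
    ultimately show "g (y j) \<le> 4 / a\<^sup>2 * cosh (a * y j) + (56 * B)\<^sup>2" unfolding g_def by linarith
  qed
  then show ?thesis by (simp add: sum.distrib V_def sum_distrib_left)
qed

text \<open>If \<open>V\<close> is of order \<open>n\<close>, the squared deviations sum to
  \<open>O(n / a^2)\<close> by \<open>sum_g_le\<close>, and the factor \<open>lam\<close> makes
  \<open>Q\<close> bounded. The constants are \<open>2288 = 52 * 44\<close> and
  \<open>14 = 13 + 1\<close>, the last 1 for the change \<open>xi i\<close>.\<close>

lemma drift_small:
  assumes small: "V a < 44 / c * n"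
  shows "(\<Sum>i\<in>{1..n}. q i * (V' a i * exp (Q' i))) \<le> 88 / c * exp (2288 / c + 14) * n"
proof -
  have "Q \<le> lam * (4 / a\<^sup>2 * V a + n * (56 * B)\<^sup>2)"
    unfolding Q_def using lam_pos sum_g_le by (intro mult_left_mono) auto
  also have "\<dots> = 52 / n * V a + 13 * (56 * B * a)\<^sup>2"
    using a_pos n_pos by (simp add: lam_def field_simps power_mult_distrib)
  also have "\<dots> \<le> 52 / n * (44 / c * n) + 13 * 1"
  proof -
    have "(56 * B * a)\<^sup>2 \<le> 1\<^sup>2" using a_le a_pos B_pos by (intro power_mono) auto
    then show ?thesis using small n_pos by (intro add_mono mult_left_mono) auto
  qed
  also have "\<dots> = 2288 / c + 13" using n_pos by simp
  finally have Q: "Q \<le> 2288 / c + 13" .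
  have "V' a i * exp (Q' i) \<le> (2 * (44 / c * n)) * exp (2288 / c + 14)" if i: "i \<in> {1..n}" for i
  proof (intro mult_mono)
    show "V' a i \<le> 2 * (44 / c * n)" using V'_le[OF i] small by simp
    have "Q' i \<le> 2288 / c + 14" using Q abs_xi_le_eta[OF i] eta_le by (simp add: xi_def)
    then show "exp (Q' i) \<le> exp (2288 / c + 14)" by simp
  qed (use c_pos n_pos in auto)
  then have "(\<Sum>i\<in>{1..n}. q i * (V' a i * exp (Q' i))) \<le> (\<Sum>i\<in>{1..n}. q i * (2 * (44 / c * n) * exp (2288 / c + 14)))"
    by (intro sum_mono mult_left_mono q_nonneg)
  also have "\<dots> = 2 * (44 / c * n) * exp (2288 / c + 14)"
    unfolding sum_distrib_right[symmetric] sum_q by simp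
  finally show ?thesis by (simp add: mult_ac)
qed

lemma drift:
  "(\<Sum>i\<in>{1..n}. q i * (V' a i * exp (Q' i)))
    \<le> (1 - a\<^sup>2 / n) * (V a * exp Q) + 88 / c * exp (2288 / c + 14) * n"
proof (cases "44 / c * n \<le> V a")
  case True
  have "0 \<le> 88 / c * exp (2288 / c + 14) * n" using c_pos by simp
  then show ?thesis using drift_large[OF True] by linarith
next
  case False
  have "a\<^sup>2 \<le> 1" using a_pos a_le by (intro power_le_one) auto
  then have "a\<^sup>2 / n \<le> 1" using n_ge_2 by (simp add: divide_le_eq)
  then have "0 \<le> (1 - a\<^sup>2 / n) * (V a * exp Q)" using V_nonneg by (intro mult_nonneg_nonneg) auto
  then show ?thesis using drift_small False by linarith
qed

end

section \<open>Tail bounds from a conditional drift\<close>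

lemma prob_bind_pmf:
  "measure_pmf.prob (bind_pmf p f) A = measure_pmf.expectation p (\<lambda>x. measure_pmf.prob (f x) A)"
proof -
  have "emeasure (bind_pmf p f) A = (\<integral>\<^sup>+x. ennreal (measure_pmf.prob (f x) A) \<partial>p)"
    using emeasure_bind_pmf[of p f A] by (simp only: measure_pmf.emeasure_eq_measure)
  also have "\<dots> = ennreal (measure_pmf.expectation p (\<lambda>x. measure_pmf.prob (f x) A))"
    by (intro nn_integral_eq_integral measure_pmf.integrable_const_bound[where B = 1]) auto
  finally show ?thesis
    by (simp add: measure_pmf.emeasure_eq_measure integral_nonneg)
qed

text \<open>\<open>load_pmf\<close> appends the last round; here the first round is split off, so
  that an induction can condition on the current load vector.\<close>

primrec run_pmf :: "alloc_process \<Rightarrow> nat \<Rightarrow> nat \<Rightarrow> nat \<Rightarrow> loads \<Rightarrow> loads pmf" where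
  "run_pmf P n 0 t x = return_pmf x"
| "run_pmf P n (Suc s) t x = bind_pmf (P n t x) (run_pmf P n s (Suc t))"

lemma load_pmf_add: "load_pmf P n (t + s) = bind_pmf (load_pmf P n t) (run_pmf P n s t)"
proof (induction s arbitrary: t)
  case 0
  have "run_pmf P n 0 t = return_pmf" by (rule ext) simp
  then show ?case by (simp add: bind_return_pmf')
next
  case (Suc s)
  have "load_pmf P n (t + Suc s) = load_pmf P n (Suc t + s)" by simp
  also have "\<dots> = bind_pmf (load_pmf P n (Suc t)) (run_pmf P n s (Suc t))" by (rule Suc.IH)
  finally show ?case by (simp add: bind_assoc_pmf)
qed

lemma expectation_pmf_mono:
  assumes "finite (set_pmf p)" "\<And>x. x \<in> set_pmf p \<Longrightarrow> f x \<le> (g x :: real)"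
  shows "measure_pmf.expectation p f \<le> measure_pmf.expectation p g"
  using assms by (intro integral_mono_AE integrable_measure_pmf_finite) (auto simp: AE_measure_pmf_iff)

locale drift_process =
  fixes P :: alloc_process and n :: nat and G :: "loads set" and \<Psi> :: "loads \<Rightarrow> real" and \<rho> C :: real
  assumes finite_step: "\<And>t x. x \<in> set_pmf (load_pmf P n t) \<Longrightarrow> finite (set_pmf (P n t x))"
    and \<rho>: "0 < \<rho>" "\<rho> \<le> 1" and C: "0 \<le> C" and \<Psi>: "\<And>x. 0 \<le> \<Psi> x"
    and step: "\<And>t x. x \<in> set_pmf (load_pmf P n t) \<Longrightarrow> x \<in> G \<Longrightarrow>
      measure_pmf.expectation (P n t x) \<Psi> \<le> (1 - \<rho>) * \<Psi> x + C"
begin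

lemma finite_load: "finite (set_pmf (load_pmf P n t))"
  by (induction t) (auto intro: finite_step)

lemma run_tail:
  assumes \<Lambda>: "0 < \<Lambda>" and x: "x \<in> set_pmf (load_pmf P n t)"
  shows "measure_pmf.prob (run_pmf P n s t x) {z. \<Lambda> \<le> \<Psi> z}
    \<le> ((1 - \<rho>) ^ s * \<Psi> x + C * ((1 - (1 - \<rho>) ^ s) / \<rho>)) / \<Lambda>
      + (\<Sum>r<s. measure_pmf.prob (run_pmf P n r t x) (- G))"
  using x
proof (induction s arbitrary: t x)
  case 0
  have "indicator {z. \<Lambda> \<le> \<Psi> z} x \<le> \<Psi> x / \<Lambda>"
    using \<Lambda> \<Psi>[of x] by (auto simp: indicator_def le_divide_eq)
  then show ?case by simp
next
  case (Suc s)
  let ?A = "{z. \<Lambda> \<le> \<Psi> z}"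
  let ?K = "C * ((1 - (1 - \<rho>) ^ s) / \<rho>)"
  have p: "0 \<le> (1 - \<rho>) ^ k" "(1 - \<rho>) ^ k \<le> 1" for k
    using \<rho> by (auto intro: power_le_one)
  show ?case
  proof (cases "x \<in> G")
    case False
    have "measure_pmf.prob (run_pmf P n (Suc s) t x) ?A \<le> measure_pmf.prob (run_pmf P n 0 t x) (- G)"
      using False by simp
    also have "\<dots> \<le> (\<Sum>r<Suc s. measure_pmf.prob (run_pmf P n r t x) (- G))"
      by (rule member_le_sum) auto
    also have "\<dots> \<le> ((1 - \<rho>) ^ Suc s * \<Psi> x + C * ((1 - (1 - \<rho>) ^ Suc s) / \<rho>)) / \<Lambda> + \<dots>"
      using p[of "Suc s"] \<rho> C \<Psi>[of x] \<Lambda> by (simp del: power_Suc)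
    finally show ?thesis .
  next
    case True
    let ?p = "P n t x"
    have fin: "finite (set_pmf ?p)" using finite_step[OF Suc.prems] .
    note int = integrable_measure_pmf_finite[OF fin]
    have "measure_pmf.prob (run_pmf P n (Suc s) t x) ?A
        = measure_pmf.expectation ?p (\<lambda>z. measure_pmf.prob (run_pmf P n s (Suc t) z) ?A)"
      by (simp add: prob_bind_pmf)
    also have "\<dots> \<le> measure_pmf.expectation ?p (\<lambda>z. ((1 - \<rho>) ^ s * \<Psi> z + ?K) / \<Lambda>
        + (\<Sum>r<s. measure_pmf.prob (run_pmf P n r (Suc t) z) (- G)))"
      using Suc.prems by (intro expectation_pmf_mono fin Suc.IH) auto
    also have "\<dots> = ((1 - \<rho>) ^ s * measure_pmf.expectation ?p \<Psi> + ?K) / \<Lambda>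
        + (\<Sum>r<s. measure_pmf.expectation ?p (\<lambda>z. measure_pmf.prob (run_pmf P n r (Suc t) z) (- G)))"
      by (simp add: int Bochner_Integration.integral_add Bochner_Integration.integral_sum add_divide_distrib)
    also have "(\<Sum>r<s. measure_pmf.expectation ?p (\<lambda>z. measure_pmf.prob (run_pmf P n r (Suc t) z) (- G)))
        = (\<Sum>r<s. measure_pmf.prob (run_pmf P n (Suc r) t x) (- G))"
      by (simp add: prob_bind_pmf)
    also have "\<dots> \<le> (\<Sum>r<Suc s. measure_pmf.prob (run_pmf P n r t x) (- G))"
      by (subst sum.lessThan_Suc_shift) simp
    also have "((1 - \<rho>) ^ s * measure_pmf.expectation ?p \<Psi> + ?K) / \<Lambda>
        \<le> ((1 - \<rho>) ^ s * ((1 - \<rho>) * \<Psi> x + C) + ?K) / \<Lambda>"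
      using \<Lambda> p step[OF Suc.prems True] by (intro divide_right_mono add_right_mono mult_left_mono) auto
    also have "(1 - \<rho>) ^ s * ((1 - \<rho>) * \<Psi> x + C) + ?K
        = (1 - \<rho>) ^ Suc s * \<Psi> x + C * ((1 - (1 - \<rho>) ^ Suc s) / \<rho>)"
      using \<rho> by (simp add: field_simps)
    finally show ?thesis by simp
  qed
qed

lemma run_tail':
  assumes \<Lambda>: "0 < \<Lambda>" and x: "x \<in> set_pmf (load_pmf P n t)"
  shows "measure_pmf.prob (run_pmf P n s t x) {z. \<Lambda> \<le> \<Psi> z}
    \<le> ((1 - \<rho>) ^ s * \<Psi> x + C / \<rho>) / \<Lambda> + (\<Sum>r<s. measure_pmf.prob (run_pmf P n r t x) (- G))"
proof -
  have "C * ((1 - (1 - \<rho>) ^ s) / \<rho>) \<le> C * (1 / \<rho>)"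
    using C \<rho> by (intro mult_left_mono divide_right_mono) auto
  then have "((1 - \<rho>) ^ s * \<Psi> x + C * ((1 - (1 - \<rho>) ^ s) / \<rho>)) / \<Lambda> \<le> ((1 - \<rho>) ^ s * \<Psi> x + C / \<rho>) / \<Lambda>"
    using \<Lambda> by (intro divide_right_mono add_left_mono) auto
  then show ?thesis using run_tail[OF assms, of s] by linarith
qed

lemma load_tail_from_start:
  assumes \<Lambda>: "0 < \<Lambda>" and bad: "\<And>t. measure_pmf.prob (load_pmf P n t) (- G) \<le> \<pi>"
  shows "measure_pmf.prob (load_pmf P n m) {z. \<Lambda> \<le> \<Psi> z} \<le> (\<Psi> (\<lambda>_. 0) + C / \<rho>) / \<Lambda> + m * \<pi>"
proof -
  have run: "run_pmf P n r 0 (\<lambda>_. 0) = load_pmf P n r" for r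
    using load_pmf_add[of P n 0 r] by (simp add: bind_return_pmf)
  have "measure_pmf.prob (load_pmf P n m) {z. \<Lambda> \<le> \<Psi> z}
    \<le> ((1 - \<rho>) ^ m * \<Psi> (\<lambda>_. 0) + C / \<rho>) / \<Lambda> + (\<Sum>r<m. measure_pmf.prob (load_pmf P n r) (- G))"
    using run_tail'[OF \<Lambda>, of "\<lambda>_. 0" 0 m] by (simp add: run)
  also have "(1 - \<rho>) ^ m * \<Psi> (\<lambda>_. 0) \<le> 1 * \<Psi> (\<lambda>_. 0)"
    using \<rho> \<Psi> by (intro mult_right_mono power_le_one) auto
  also have "(\<Sum>r<m. measure_pmf.prob (load_pmf P n r) (- G)) \<le> (\<Sum>r<m. \<pi>)"
    by (intro sum_mono bad)
  finally show ?thesis using \<Lambda> by (simp add: divide_right_mono)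
qed

text \<open>Looking back only \<open>s\<close> rounds makes the union bound independent of
  \<open>m\<close>. The extra 1 in \<open>real s + 1\<close> is for being outside \<open>G\<close>
  at the beginning of the window; if \<open>m < s\<close>, the window starts from empty
  bins.\<close>

lemma load_tail:
  assumes \<Lambda>: "0 < \<Lambda>" and bad: "\<And>t. measure_pmf.prob (load_pmf P n t) (- G) \<le> \<pi>"
    and U: "\<And>x. x \<in> G \<Longrightarrow> \<Psi> x \<le> U" and U0: "0 \<le> U"
  shows "measure_pmf.prob (load_pmf P n m) {z. \<Lambda> \<le> \<Psi> z}
    \<le> ((1 - \<rho>) ^ s * U + \<Psi> (\<lambda>_. 0) + C / \<rho>) / \<Lambda> + (real s + 1) * \<pi>"
proof (cases "s \<le> m")
  case False
  have "0 \<le> \<pi>" using bad[of 0] by (rule order_trans[rotated]) simp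
  then have "m * \<pi> \<le> (real s + 1) * \<pi>" using False by (intro mult_right_mono) auto
  moreover have "(\<Psi> (\<lambda>_. 0) + C / \<rho>) / \<Lambda> \<le> ((1 - \<rho>) ^ s * U + \<Psi> (\<lambda>_. 0) + C / \<rho>) / \<Lambda>"
    using \<Lambda> \<rho> U0 by (intro divide_right_mono) auto
  ultimately show ?thesis using load_tail_from_start[OF \<Lambda> bad, of m] by linarith
next
  case True
  define t where "t = m - s"
  have m: "m = t + s" using True by (simp add: t_def)
  let ?p = "load_pmf P n t" and ?K = "((1 - \<rho>) ^ s * U + C / \<rho>) / \<Lambda>"
  note int = integrable_measure_pmf_finite[OF finite_load[of t]]
  have "measure_pmf.prob (run_pmf P n s t x) {z. \<Lambda> \<le> \<Psi> z}
      \<le> indicator (- G) x + ?K + (\<Sum>r<s. measure_pmf.prob (run_pmf P n r t x) (- G))"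
    if x: "x \<in> set_pmf ?p" for x
  proof (cases "x \<in> G")
    case False
    have "0 \<le> ?K" using \<rho> C U0 \<Lambda> by simp
    moreover have "0 \<le> (\<Sum>r<s. measure_pmf.prob (run_pmf P n r t x) (- G))" by (simp add: sum_nonneg)
    moreover have "measure_pmf.prob (run_pmf P n s t x) {z. \<Lambda> \<le> \<Psi> z} \<le> 1" by simp
    moreover have "indicat_real (- G) x = 1" using False by simp
    ultimately show ?thesis by linarith
  next
    case True
    have "(1 - \<rho>) ^ s * \<Psi> x \<le> (1 - \<rho>) ^ s * U"
      using \<rho> U[OF True] by (intro mult_left_mono) auto
    then have "((1 - \<rho>) ^ s * \<Psi> x + C / \<rho>) / \<Lambda> \<le> ?K"
      using \<Lambda> by (intro divide_right_mono) auto
    then show ?thesis using run_tail'[OF \<Lambda> x, of s] True by simp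
  qed
  then have "measure_pmf.expectation ?p (\<lambda>x. measure_pmf.prob (run_pmf P n s t x) {z. \<Lambda> \<le> \<Psi> z})
    \<le> measure_pmf.expectation ?p (\<lambda>x. indicator (- G) x + ?K + (\<Sum>r<s. measure_pmf.prob (run_pmf P n r t x) (- G)))"
    by (intro expectation_pmf_mono finite_load)
  also have "\<dots> = measure_pmf.prob ?p (- G) + ?K
     + (\<Sum>r<s. measure_pmf.expectation ?p (\<lambda>x. measure_pmf.prob (run_pmf P n r t x) (- G)))"
    by (simp add: int Bochner_Integration.integral_add Bochner_Integration.integral_sum)
  also have "\<dots> = measure_pmf.prob ?p (- G) + ?K + (\<Sum>r<s. measure_pmf.prob (load_pmf P n (t + r)) (- G))"
    by (simp add: load_pmf_add prob_bind_pmf)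
  also have "\<dots> \<le> \<pi> + ?K + (\<Sum>r<s. \<pi>)"
    by (intro add_mono bad sum_mono order_refl)
  also have "\<dots> = ?K + (real s + 1) * \<pi>" by (simp add: algebra_simps)
  finally have "measure_pmf.prob (load_pmf P n m) {z. \<Lambda> \<le> \<Psi> z} \<le> ?K + (real s + 1) * \<pi>"
    unfolding m load_pmf_add prob_bind_pmf .
  moreover have "?K \<le> ((1 - \<rho>) ^ s * U + \<Psi> (\<lambda>_. 0) + C / \<rho>) / \<Lambda>"
    using \<Lambda> \<Psi> by (intro divide_right_mono) auto
  ultimately show ?thesis by linarith
qed

end

section \<open>Concentration for biased allocation processes\<close>

definition dev :: "nat \<Rightarrow> loads \<Rightarrow> nat \<Rightarrow> real" where
  "dev n x j = real (x j) - real (total_load n x) / real n"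

lemma sum_dev: "n \<noteq> 0 \<Longrightarrow> (\<Sum>j\<in>{1..n}. dev n x j) = 0"
  by (simp add: dev_def sum_subtractf total_load_def)

lemma total_load_add_balls:
  assumes "i \<in> {1..n}"
  shows "total_load n (add_balls k i x) = total_load n x + k"
proof -
  have "total_load n (add_balls k i x) = (\<Sum>j\<in>{1..n}. x j + (if j = i then k else 0))"
    unfolding total_load_def add_balls_def by (intro sum.cong) auto
  then show ?thesis using assms by (simp add: sum.distrib total_load_def)
qed

definition biased_allocation :: "real \<Rightarrow> nat \<Rightarrow> loads \<Rightarrow> loads pmf \<Rightarrow> bool" where
  "biased_allocation \<beta> n x p \<longleftrightarrow> (\<exists>q W. p = map_pmf (\<lambda>i. add_balls (W i) i x) q \<and> set_pmf q \<subseteq> {1..n}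
     \<and> biased_step n (dev n x) (pmf q) (\<lambda>i. real (W i)) \<beta>)"

lemma finite_biased_allocation:
  assumes "biased_allocation \<beta> n x p"
  shows "finite (set_pmf p)"
proof -
  obtain q W where "p = map_pmf (\<lambda>i. add_balls (W i) i x) q" "set_pmf q \<subseteq> {1..n}"
    using assms unfolding biased_allocation_def by blast
  moreover from this(2) have "finite (set_pmf q)" by (rule finite_subset) simp
  ultimately show ?thesis by simp
qed

lemma expectation_allocation:
  fixes F :: "loads \<Rightarrow> real"
  assumes "set_pmf q \<subseteq> {1..n}"
  shows "measure_pmf.expectation (map_pmf (\<lambda>i. add_balls (W i) i x) q) F
    = (\<Sum>i\<in>{1..n}. pmf q i * F (add_balls (W i) i x))"
  using assms by (subst integral_map_pmf, subst integral_measure_pmf_real[where A = "{1..n}"])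
    (auto simp: mult.commute)

definition cosh_potential :: "real \<Rightarrow> nat \<Rightarrow> loads \<Rightarrow> real" where
  "cosh_potential a n x = (\<Sum>j\<in>{1..n}. cosh (a * dev n x j))"

definition well_potential :: "real \<Rightarrow> real \<Rightarrow> nat \<Rightarrow> loads \<Rightarrow> real" where
  "well_potential B a n x =
     13 * a\<^sup>2 / n * (\<Sum>j\<in>{1..n}. (dev n x j)\<^sup>2 - 56 * huber B (dev n x j) + (56 * B)\<^sup>2)"

lemma dev_add_balls:
  assumes "i \<in> {1..n}" "biased_step n y q (\<lambda>i. real (W i)) \<beta>"
  shows "dev n (add_balls (W i) i x) j = dev n x j + biased_step.d n (\<lambda>i. real (W i)) i j"
  unfolding dev_def total_load_add_balls[OF assms(1)] biased_step.d_def[OF assms(2)]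
  by (simp add: add_balls_def add_divide_distrib)

lemma cosh_potential_drift:
  assumes p: "biased_allocation \<beta> n x p" and a: "a = \<beta> / (24 * n)"
  shows "measure_pmf.expectation p (cosh_potential a n)
    \<le> (1 - a * \<beta> / (2 * n\<^sup>2)) * cosh_potential a n x + a * \<beta> / n"
proof -
  obtain q W where q: "p = map_pmf (\<lambda>i. add_balls (W i) i x) q" "set_pmf q \<subseteq> {1..n}"
    and bs: "biased_step n (dev n x) (pmf q) (\<lambda>i. real (W i)) \<beta>"
    using p unfolding biased_allocation_def by auto
  interpret biased_step n "dev n x" "pmf q" "\<lambda>i. real (W i)" \<beta> by (rule bs)
  have "cosh_potential a n (add_balls (W i) i x) = V' a i" if "i \<in> {1..n}" for i
    unfolding cosh_potential_def V'_def dev_add_balls[OF that bs] ..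
  moreover have "cosh_potential a n x = V a" by (simp add: cosh_potential_def V_def)
  ultimately show ?thesis
    using mean_V'_coarse[OF a] unfolding q(1) expectation_allocation[OF q(2)] by simp
qed

text \<open>The constants depend on \<open>\<beta>\<close> alone. The smallness of \<open>a\<close>
  is collected in \<open>a0\<close>, that of \<open>\<eta>\<close> in the condition with
  \<open>e\<close>, where \<open>R\<close> may grow with \<open>n\<close>.\<close>

lemma combined_potential_drift:
  assumes beta: "0 < \<beta>" "\<beta> \<le> 1"
  obtains B C a0 e where "0 < B" "0 < C" "0 < a0" "a0 \<le> 1" "0 < e"
    "\<And>n x p a R. biased_allocation \<beta> n x p \<Longrightarrow> 0 < a \<Longrightarrow> a \<le> a0 \<Longrightarrow> a\<^sup>2 * (R + 1) / n \<le> e \<Longrightarrow>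
       \<forall>j\<in>{1..n}. \<bar>dev n x j\<bar> \<le> R \<Longrightarrow>
       measure_pmf.expectation p (\<lambda>x. cosh_potential a n x * exp (well_potential B a n x))
         \<le> (1 - a\<^sup>2 / n) * (cosh_potential a n x * exp (well_potential B a n x)) + C * n"
proof -
  define B where "B = 56 / \<beta> + 2"
  define D where "D = (12 + 896 * B) / \<beta>"
  define s where "s = 1 / (112 * B)"
  define c where "c = s / 4"
  define T where "T = 16 * D / s"
  define S where "S = {1 / 4, c / 48, 1 / T, c / (26 * (6 + 448 * B)), 1 / (56 * B), \<beta> / 128, 1 / (8 * (4 + 448 * B))}"
  define a0 where "a0 = Min S"
  define e where "e = Min {1, \<beta> / 64, 1 / (4 * (4 + 448 * B))} / (13 * (4 + 448 * B))"
  define C where "C = 88 / c * exp (2288 / c + 14)"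
  have pos: "0 < B" "0 < D" "0 < s" "0 < c" "0 < T"
  proof -
    show B: "0 < B" using beta by (simp add: B_def add_pos_pos)
    then show D: "0 < D" using beta by (simp add: D_def add_pos_pos)
    show s: "0 < s" using B by (simp add: s_def)
    then show "0 < c" by (simp add: c_def)
    show "0 < T" using D s by (simp add: T_def)
  qed
  have posB: "0 < 4 + 448 * B" "0 < 6 + 448 * B" using pos by (auto intro: add_pos_pos)
  have S: "finite S" "S \<noteq> {}" "1 / 4 \<in> S" by (simp_all add: S_def)
  have "\<forall>u\<in>S. 0 < u" using pos posB beta by (simp add: S_def)
  then have a0: "0 < a0" "a0 \<le> 1"
    using S Min_le[OF S(1,3)] by (simp_all add: a0_def)
  have e0: "0 < e" using posB beta by (simp add: e_def)
  have C0: "0 < C" using pos by (simp add: C_def)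
  have "measure_pmf.expectation p (\<lambda>x. cosh_potential a n x * exp (well_potential B a n x))
         \<le> (1 - a\<^sup>2 / n) * (cosh_potential a n x * exp (well_potential B a n x)) + C * n"
    if p: "biased_allocation \<beta> n x p" and a: "0 < a" "a \<le> a0" and small: "a\<^sup>2 * (R + 1) / n \<le> e"
      and R: "\<forall>j\<in>{1..n}. \<bar>dev n x j\<bar> \<le> R" for n x p a R
  proof -
    obtain q W where q: "p = map_pmf (\<lambda>i. add_balls (W i) i x) q" "set_pmf q \<subseteq> {1..n}"
      and bs: "biased_step n (dev n x) (pmf q) (\<lambda>i. real (W i)) \<beta>"
      using p unfolding biased_allocation_def by auto
    interpret biased_step n "dev n x" "pmf q" "\<lambda>i. real (W i)" \<beta> by (rule bs)
    have "0 \<le> \<bar>dev n x 1\<bar>" "\<bar>dev n x 1\<bar> \<le> R" using R n_ge_2 by auto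
    then have R0: "0 \<le> R" by linarith
    define \<eta> where "\<eta> = 13 * a\<^sup>2 / n * (4 * R + 4 + 448 * B)"
    have "\<eta> \<le> 13 * a\<^sup>2 / n * ((4 + 448 * B) * (R + 1))" unfolding \<eta>_def
      using pos R0 by (intro mult_left_mono) (auto simp: algebra_simps)
    also have "\<dots> = (13 * (4 + 448 * B)) * (a\<^sup>2 * (R + 1) / n)" by simp
    also have "\<dots> \<le> (13 * (4 + 448 * B)) * e" using small pos by (intro mult_left_mono) auto
    also have "\<dots> = Min {1, \<beta> / 64, 1 / (4 * (4 + 448 * B))}"
      using posB(1) by (simp add: e_def)
    finally have "\<forall>u\<in>{1, \<beta> / 64, 1 / (4 * (4 + 448 * B))}. \<eta> \<le> u"
      by (simp only: Min_ge_iff finite.intros insert_not_empty not_False_eq_True)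
    then have eta: "\<eta> \<le> 1" "\<eta> \<le> \<beta> / 64" "\<eta> \<le> 1 / (4 * (4 + 448 * B))" by blast+
    have aS: "a \<le> u" if "u \<in> S" for u using a(2) Min_le[OF S(1) that] unfolding a0_def by (rule order_trans)
    have al: "a \<le> 1 / 4" "a \<le> c / 48" "a \<le> 1 / T" "a \<le> c / (26 * (6 + 448 * B))" "a \<le> 1 / (56 * B)"
      "a \<le> \<beta> / 128" "a \<le> 1 / (8 * (4 + 448 * B))"
      by (rule aS, unfold S_def, blast)+
    interpret fine_step n "dev n x" "pmf q" "\<lambda>i. real (W i)" \<beta> B D s c T a R \<eta>
    proof
      show "48 * a \<le> c" using al(2) by simp
      show "26 * (6 + 448 * B) * a \<le> c" using al(4) posB by (simp add: le_divide_eq mult_ac)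
      show "8 * (4 + 448 * B) * a \<le> 1" using al(7) posB by (simp add: le_divide_eq mult_ac)
      show "4 * (4 + 448 * B) * \<eta> \<le> 1" using eta(3) posB by (simp add: le_divide_eq mult_ac)
      show "56 * B * a \<le> 1" using al(5) pos by (simp add: le_divide_eq mult_ac)
      show "a * T \<le> 1" using al(3) pos by (simp add: le_divide_eq mult_ac)
    qed (use beta pos al eta R a in \<open>auto simp: B_def D_def s_def c_def T_def \<eta>_def\<close>)
    have "cosh_potential a n (add_balls (W i) i x) = V' a i" if "i \<in> {1..n}" for i
      unfolding cosh_potential_def V'_def dev_add_balls[OF that bs] ..
    moreover have "well_potential B a n (add_balls (W i) i x) = Q' i" if "i \<in> {1..n}" for i
      unfolding well_potential_def Q'_def lam_def g_def dev_add_balls[OF that bs] ..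
    moreover have "cosh_potential a n x = V a" by (simp add: cosh_potential_def V_def)
    moreover have "well_potential B a n x = Q"
      by (simp add: well_potential_def Q_def lam_def g_def)
    ultimately show ?thesis
      using drift unfolding q(1) expectation_allocation[OF q(2)] by (simp add: C_def)
  qed
  with pos(1) C0 a0 e0 show thesis by (rule that)
qed

section \<open>Tail bounds for the deviations\<close>

lemma cosh_potential_gt:
  assumes "0 \<le> a" "j \<in> {1..n}" "L < \<bar>dev n x j\<bar>"
  shows "exp (a * L) / 2 \<le> cosh_potential a n x"
proof -
  have "a * L \<le> \<bar>a * dev n x j\<bar>" using assms by (simp add: abs_mult mult_left_mono)
  then have "exp (a * L) \<le> 2 * cosh (a * dev n x j)"
    by (intro order_trans[OF _ exp_abs_le_cosh]) simp
  moreover have "cosh (a * dev n x j) \<le> cosh_potential a n x"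
    unfolding cosh_potential_def using assms(2) by (intro member_le_sum) auto
  ultimately show ?thesis by simp
qed

lemma dev_zero: "dev n (\<lambda>_. 0) j = 0"
  by (simp add: dev_def total_load_def)

lemma cosh_potential_nonneg: "0 \<le> cosh_potential a n x"
  by (simp add: cosh_potential_def sum_nonneg)

definition far :: "nat \<Rightarrow> real \<Rightarrow> loads set" where
  "far n R = {x. \<exists>j\<in>{1..n}. R < \<bar>dev n x j\<bar>}"

text \<open>Only reachable load vectors are considered: there the total load of the threshold
  processes is \<open>t\<close>, so that their threshold \<open>t / n\<close> is the mean
  load.\<close>

definition biased_process :: "real \<Rightarrow> alloc_process \<Rightarrow> nat \<Rightarrow> bool" where
  "biased_process \<beta> P n \<longleftrightarrow> (\<forall>t. \<forall>x\<in>set_pmf (load_pmf P n t). biased_allocation \<beta> n x (P n t x))"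

lemma biased_processD:
  "biased_process \<beta> P n \<Longrightarrow> x \<in> set_pmf (load_pmf P n t) \<Longrightarrow> biased_allocation \<beta> n x (P n t x)"
  by (simp add: biased_process_def)

text \<open>The constant is \<open>672 = 24 \<cdot> 28\<close>: with \<open>a = \<beta>/(24n)\<close> a bin outside the range contributes \<open>n\<^sup>2\<^sup>8\<close> to the potential.\<close>

lemma coarse_tail:
  assumes n: "2 \<le> n" and beta: "0 < \<beta>" "\<beta> \<le> 1"
    and P: "biased_process \<beta> P n"
  shows "measure_pmf.prob (load_pmf P n m) (far n (672 / \<beta> * n * ln n)) \<le> 1 / real n ^ 24"
proof -
  define a where "a = \<beta> / (24 * n)"
  define \<rho> where "\<rho> = a * \<beta> / (2 * n\<^sup>2)"
  have n0: "0 < real n" using n by simp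
  have a: "0 < a" "a \<le> 1" using n beta by (auto simp: a_def divide_le_eq)
  have \<rho>: "0 < \<rho>" "\<rho> \<le> 1"
  proof -
    show "0 < \<rho>" using a beta n0 by (simp add: \<rho>_def)
    have "a * \<beta> \<le> 1 * 1" using a beta by (intro mult_mono) auto
    also have "\<dots> \<le> 2 * real (n\<^sup>2)" using n one_le_power[of "real n" 2] by (simp only: of_nat_power) linarith
    finally show "\<rho> \<le> 1" using n0 by (simp add: \<rho>_def divide_le_eq)
  qed
  interpret drift_process P n UNIV "cosh_potential a n" \<rho> "a * \<beta> / n"
  proof
    show "measure_pmf.expectation (P n t x) (cosh_potential a n) \<le> (1 - \<rho>) * cosh_potential a n x + a * \<beta> / n"
      if "x \<in> set_pmf (load_pmf P n t)" for t x
      using cosh_potential_drift[OF biased_processD[OF P that] a_def] by (simp add: \<rho>_def)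
  qed (use a beta \<rho> cosh_potential_nonneg finite_biased_allocation[OF biased_processD[OF P]] in auto)
  have "(a * (672 / \<beta> * n * ln n)) = 28 * ln n" using beta n0 by (simp add: a_def field_simps)
  then have e: "exp (a * (672 / \<beta> * n * ln n)) = real n ^ 28"
    using n0 by (simp add: exp_of_nat_mult[of 28, simplified])
  have "far n (672 / \<beta> * n * ln n) \<subseteq> {z. real n ^ 28 / 2 \<le> cosh_potential a n z}"
    using cosh_potential_gt[of a _ n "672 / \<beta> * n * ln n"] a unfolding e far_def by fastforce
  then have "measure_pmf.prob (load_pmf P n m) (far n (672 / \<beta> * n * ln n))
      \<le> measure_pmf.prob (load_pmf P n m) {z. real n ^ 28 / 2 \<le> cosh_potential a n z}"
    by (intro measure_pmf.finite_measure_mono) auto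
  also have "\<dots> \<le> (cosh_potential a n (\<lambda>_. 0) + a * \<beta> / n / \<rho>) / (real n ^ 28 / 2) + real m * 0"
    using n0 by (intro load_tail_from_start) auto
  also have "cosh_potential a n (\<lambda>_. 0) = n" by (simp add: cosh_potential_def dev_zero)
  also have "a * \<beta> / n / \<rho> = 2 * real n" using a beta n0 by (simp add: \<rho>_def power2_eq_square)
  also have "(real n + 2 * real n) / (real n ^ 28 / 2) + real m * 0 = 6 / real n ^ 27"
    using n0 by (simp add: field_simps power_Suc[symmetric] del: power_Suc)
  \<comment> \<open>24 is 4 + 10 + 10: each of the two applications of \<open>fine_tail\<close> to
    follow loses a factor \<open>n^10\<close>.\<close>
  also have "\<dots> \<le> 1 / real n ^ 24"
  proof -
    have "(2::real) ^ 3 \<le> real n ^ 3" using n by (intro power_mono) auto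
    then have "6 * real n ^ 24 \<le> real n ^ 3 * real n ^ 24" by (intro mult_right_mono) auto
    then show ?thesis using n0 by (simp add: field_simps power_add[symmetric])
  qed
  finally show ?thesis .
qed

text \<open>
  Starting \<open>n\<^sup>8\<close> rounds before \<open>m\<close> suffices for the potential to forget its value at the start; a union bound
  over these rounds costs the factor \<open>n\<^sup>1\<^sup>0\<close> in the error probability.
\<close>

lemma fine_tail:
  assumes beta: "0 < \<beta>" "\<beta> \<le> 1"
  obtains a0 e n0 where "0 < a0" "a0 \<le> 1" "0 < e"
    "\<And>P n a R k m. n0 \<le> n \<Longrightarrow>
      biased_process \<beta> P n \<Longrightarrow>
      0 < a \<Longrightarrow> a \<le> a0 \<Longrightarrow> 1 \<le> a\<^sup>2 * n \<Longrightarrow> 0 \<le> R \<Longrightarrow> R \<le> real n ^ 2 \<Longrightarrow> a\<^sup>2 * (R + 1) / n \<le> e \<Longrightarrow> k \<le> 14 \<Longrightarrow>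
      \<forall>t. measure_pmf.prob (load_pmf P n t) (far n R) \<le> 1 / real n ^ (k + 10) \<Longrightarrow>
      measure_pmf.prob (load_pmf P n m) (far n (20 * ln n / a)) \<le> 1 / real n ^ k"
proof -
  obtain B C a0 e where
    BC: "0 < B" "0 < C" and a0: "0 < a0" "a0 \<le> 1" and e: "0 < e" and
    drift: "\<And>n x p a R. biased_allocation \<beta> n x p \<Longrightarrow> 0 < a \<Longrightarrow> a \<le> a0 \<Longrightarrow> a\<^sup>2 * (R + 1) / n \<le> e \<Longrightarrow>
       \<forall>j\<in>{1..n}. \<bar>dev n x j\<bar> \<le> R \<Longrightarrow>
       measure_pmf.expectation p (\<lambda>x. cosh_potential a n x * exp (well_potential B a n x))
         \<le> (1 - a\<^sup>2 / n) * (cosh_potential a n x * exp (well_potential B a n x)) + C * n"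
    by (rule combined_potential_drift[OF beta]) (rule that; assumption)
  define b where "b = 13 * (56 * B)\<^sup>2"
  have b0: "0 \<le> b" by (simp add: b_def)
  \<comment> \<open>The first estimate bounds the logarithm of \<open>U\<close> below by
    \<open>n^6\<close>; the second collects the forgotten start, the potential of empty bins and the
    equilibrium level.\<close>
  have "\<forall>\<^sub>F n in sequentially. ln (real n) + (real n ^ 2 + 13 * real n ^ 4 + b) \<le> real n ^ 6"
    by real_asymp
  moreover have "\<forall>\<^sub>F n in sequentially. 1 + real n * exp b + C * real n ^ 3 \<le> real n ^ 4"
    by real_asymp
  ultimately have "\<forall>\<^sub>F n in sequentially. 2 \<le> n \<and> ln (real n) + (real n ^ 2 + 13 * real n ^ 4 + b) \<le> real n ^ 6
      \<and> 1 + real n * exp b + C * real n ^ 3 \<le> real n ^ 4"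
    using eventually_ge_at_top[of 2] by eventually_elim auto
  then obtain n0 where n0: "\<And>n. n0 \<le> n \<Longrightarrow> 2 \<le> n"
    "\<And>n. n0 \<le> n \<Longrightarrow> ln (real n) + (real n ^ 2 + 13 * real n ^ 4 + b) \<le> real n ^ 6"
    "\<And>n. n0 \<le> n \<Longrightarrow> 1 + real n * exp b + C * real n ^ 3 \<le> real n ^ 4"
    unfolding eventually_sequentially by blast
  show thesis
  proof (rule that[OF a0 e])
    fix P :: alloc_process and n a R k m
    assume "n0 \<le> n"
    note n = n0[OF this]
    assume P: "biased_process \<beta> P n"
      and a: "0 < a" "a \<le> a0" "1 \<le> a\<^sup>2 * n" and R: "0 \<le> R" "R \<le> real n ^ 2" "a\<^sup>2 * (R + 1) / n \<le> e"
      and k: "k \<le> 14"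
      and bad: "\<forall>t. measure_pmf.prob (load_pmf P n t) (far n R) \<le> 1 / real n ^ (k + 10)"
    have npos: "0 < real n" using n(1) by simp
    have a2: "0 < a\<^sup>2" "a\<^sup>2 \<le> 1" using a a0 by (auto intro: power_le_one)
    define \<Psi> where "\<Psi> x = cosh_potential a n x * exp (well_potential B a n x)" for x
    define \<rho> where "\<rho> = a\<^sup>2 / n"
    define U where "U = n * exp (real n ^ 2 + 13 * real n ^ 4 + b)"
    have \<rho>: "0 < \<rho>" "\<rho> \<le> 1" using a2 npos n(1) by (auto simp: \<rho>_def divide_le_eq)
    have well_le: "well_potential B a n x \<le> 13 * r\<^sup>2 + b"
      if x: "\<forall>j\<in>{1..n}. \<bar>dev n x j\<bar> \<le> r" for x r
    proof -
      have "(\<Sum>j\<in>{1..n}. (dev n x j)\<^sup>2 - 56 * huber B (dev n x j) + (56 * B)\<^sup>2) \<le> (\<Sum>j\<in>{1..n}. r\<^sup>2 + (56 * B)\<^sup>2)"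
      proof (intro sum_mono)
        fix j assume "j \<in> {1..n}"
        then have "\<bar>dev n x j\<bar>\<^sup>2 \<le> r\<^sup>2" using x by (intro power_mono) auto
        moreover have "0 \<le> huber B (dev n x j)" using BC huber_nonneg by simp
        ultimately show "(dev n x j)\<^sup>2 - 56 * huber B (dev n x j) + (56 * B)\<^sup>2 \<le> r\<^sup>2 + (56 * B)\<^sup>2" by simp
      qed
      then have "well_potential B a n x \<le> 13 * a\<^sup>2 / n * (\<Sum>j\<in>{1..n}. r\<^sup>2 + (56 * B)\<^sup>2)"
        unfolding well_potential_def using a2 npos by (intro mult_left_mono) auto
      also have "\<dots> = a\<^sup>2 * (13 * r\<^sup>2 + b)" using npos by (simp add: b_def algebra_simps)
      also have "\<dots> \<le> 1 * (13 * r\<^sup>2 + b)" using a2 b0 by (intro mult_right_mono) auto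
      finally show ?thesis by simp
    qed
    have \<Psi>_nonneg: "0 \<le> \<Psi> x" for x by (simp add: \<Psi>_def cosh_potential_nonneg)
    have \<Psi>_ge: "cosh_potential a n x \<le> \<Psi> x" for x
    proof -
      have "0 \<le> (u\<^sup>2 - 56 * huber B u + (56 * B)\<^sup>2)" for u
      proof -
        have "huber B u \<le> 2 * B * \<bar>u\<bar>" using BC huber_le by simp
        moreover have "0 \<le> (\<bar>u\<bar> - 56 * B)\<^sup>2" by simp
        ultimately show ?thesis by (simp add: power2_eq_square algebra_simps)
      qed
      then have "0 \<le> well_potential B a n x"
        unfolding well_potential_def by (intro mult_nonneg_nonneg sum_nonneg) auto
      then have "cosh_potential a n x * 1 \<le> \<Psi> x"
        unfolding \<Psi>_def by (intro mult_left_mono cosh_potential_nonneg) auto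
      then show ?thesis by simp
    qed
    interpret drift_process P n "- far n R" \<Psi> \<rho> "C * n"
    proof
      show "measure_pmf.expectation (P n t x) \<Psi> \<le> (1 - \<rho>) * \<Psi> x + C * n"
        if "x \<in> set_pmf (load_pmf P n t)" "x \<in> - far n R" for t x
        unfolding \<Psi>_def \<rho>_def
        using that(2) by (intro drift[OF biased_processD[OF P that(1)] a(1,2) R(3)]) (auto simp: far_def not_less)
    qed (use \<rho> BC finite_biased_allocation[OF biased_processD[OF P]] \<Psi>_nonneg in auto)
    \<comment> \<open>From \<open>a^2 * n \<ge> 1\<close> the rate \<open>\<rho>\<close> is at least
      \<open>1 / n^2\<close>, so \<open>n^8\<close> rounds contract by at least the factor
      \<open>exp (- n^6)\<close>.\<close>
    have "(1 - \<rho>) ^ (n ^ 8) * U \<le> 1"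
    proof -
      have "(1 - \<rho>) ^ (n ^ 8) \<le> exp (- \<rho>) ^ (n ^ 8)"
        using \<rho> exp_ge_add_one_self[of "- \<rho>"] by (intro power_mono) auto
      also have "\<dots> = exp (- (\<rho> * real n ^ 8))"
        by (simp add: exp_of_nat_mult[symmetric] mult.commute)
      also have "\<dots> \<le> exp (- (real n ^ 6))"
      proof -
        have "real n ^ 6 * 1 \<le> real n ^ 6 * (a\<^sup>2 * n)" using a by (intro mult_left_mono) auto
        also have "\<dots> = \<rho> * real n ^ 8" using npos by (simp add: \<rho>_def field_simps power_Suc[symmetric] del: power_Suc)
        finally show ?thesis by simp
      qed
      finally have "(1 - \<rho>) ^ (n ^ 8) * U \<le> exp (- (real n ^ 6)) * U"
        by (intro mult_right_mono) (auto simp: U_def)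
      also have "\<dots> = exp (- (real n ^ 6)) * exp (ln (real n) + (real n ^ 2 + 13 * real n ^ 4 + b))"
        using npos by (simp add: U_def exp_add)
      also have "\<dots> \<le> 1" unfolding mult_exp_exp using n(2) by simp
      finally show ?thesis .
    qed
    moreover have "\<Psi> (\<lambda>_. 0) \<le> n * exp b"
      using well_le[of "\<lambda>_. 0" 0] unfolding \<Psi>_def
      by (intro mult_mono) (auto simp: cosh_potential_def dev_zero)
    moreover have "C * n / \<rho> \<le> C * real n ^ 3"
    proof -
      have "C * n / \<rho> = C * real n ^ 2 * (1 / a\<^sup>2)" by (simp add: \<rho>_def power2_eq_square)
      also have "\<dots> \<le> C * real n ^ 2 * n"
        using a(3) a2 BC by (intro mult_left_mono) (auto simp: divide_le_eq mult.commute)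
      finally show ?thesis by (simp add: power3_eq_cube power2_eq_square)
    qed
    ultimately have num: "(1 - \<rho>) ^ (n ^ 8) * U + \<Psi> (\<lambda>_. 0) + C * n / \<rho> \<le> real n ^ 4"
      using n(3) by linarith
    have "a * (20 * ln n / a) = 20 * ln n" using a by simp
    then have e20: "exp (a * (20 * ln n / a)) = real n ^ 20"
      using npos by (simp add: exp_of_nat_mult[of 20, simplified])
    have "far n (20 * ln n / a) \<subseteq> {z. real n ^ 20 / 2 \<le> \<Psi> z}"
    proof
      fix x assume "x \<in> far n (20 * ln n / a)"
      then obtain j where "j \<in> {1..n}" "20 * ln n / a < \<bar>dev n x j\<bar>" by (auto simp: far_def)
      then have "real n ^ 20 / 2 \<le> cosh_potential a n x"
        using cosh_potential_gt[of a j n "20 * ln n / a" x] a e20 by simp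
      then show "x \<in> {z. real n ^ 20 / 2 \<le> \<Psi> z}" using \<Psi>_ge[of x] by simp
    qed
    then have "measure_pmf.prob (load_pmf P n m) (far n (20 * ln n / a))
      \<le> measure_pmf.prob (load_pmf P n m) {z. real n ^ 20 / 2 \<le> \<Psi> z}"
      by (intro measure_pmf.finite_measure_mono) auto
    also have "\<dots> \<le> ((1 - \<rho>) ^ (n ^ 8) * U + \<Psi> (\<lambda>_. 0) + C * n / \<rho>) / (real n ^ 20 / 2)
        + (real (n ^ 8) + 1) * (1 / real n ^ (k + 10))"
    proof (rule load_tail)
      fix x assume x: "x \<in> - far n R"
      then have x': "\<forall>j\<in>{1..n}. \<bar>dev n x j\<bar> \<le> R" by (auto simp: far_def not_less)
      have "cosh_potential a n x \<le> (\<Sum>j\<in>{1..n}. exp R)" unfolding cosh_potential_def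
      proof (intro sum_mono)
        fix j assume "j \<in> {1..n}"
        have "cosh (a * dev n x j) \<le> exp \<bar>a * dev n x j\<bar>"
          by (subst cosh_real_abs[symmetric]) (simp add: cosh_field_def)
        also have "\<bar>a * dev n x j\<bar> \<le> 1 * R"
          unfolding abs_mult using a a0 x' \<open>j \<in> {1..n}\<close> by (intro mult_mono) auto
        finally show "cosh (a * dev n x j) \<le> exp R" by simp
      qed
      then have "\<Psi> x \<le> (n * exp R) * exp (13 * R\<^sup>2 + b)"
        unfolding \<Psi>_def using well_le[OF x'] by (intro mult_mono) auto
      also have "\<dots> = n * exp (R + (13 * R\<^sup>2 + b))" by (simp add: exp_add)
      also have "\<dots> \<le> U" unfolding U_def
      proof (intro mult_left_mono)
        have "R\<^sup>2 \<le> (real n ^ 2)\<^sup>2" using R by (intro power_mono) auto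
        then show "exp (R + (13 * R\<^sup>2 + b)) \<le> exp ((real n)\<^sup>2 + 13 * real n ^ 4 + b)"
          using R by (simp add: power_mult[symmetric])
      qed simp
      finally show "\<Psi> x \<le> U" .
    qed (use npos bad in \<open>auto simp: U_def\<close>)
    also have "\<dots> \<le> real n ^ 4 / (real n ^ 20 / 2) + (real n ^ 8 + real n ^ 8) * (1 / real n ^ (k + 10))"
      using num npos n(1) one_le_power[of "real n" 8]
      by (intro add_mono divide_right_mono mult_right_mono) auto
    also have "\<dots> = 2 / real n ^ 16 + 2 / real n ^ (k + 2)"
    proof -
      have e: "real n ^ 20 = real n ^ 16 * real n ^ 4" "real n ^ (k + 10) = real n ^ (k + 2) * real n ^ 8"
        by (subst power_add[symmetric], simp add: add.commute)+
      have "z / (p * z / 2) = 2 / p" "(z + z) * (1 / (p * z)) = 2 / p" if "0 < z" for p z :: real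
        using that by simp_all
      then show ?thesis unfolding e using npos by (intro arg_cong2[where f = "(+)"]) (simp only: zero_less_power)+
    qed
    \<comment> \<open>By \<open>k \<le> 14\<close> the tail of the potential is no larger than the
      union bound term.\<close>
    also have "\<dots> \<le> 2 / real n ^ (k + 2) + 2 / real n ^ (k + 2)"
    proof -
      have "real n ^ (k + 2) \<le> real n ^ 16" using k n(1) by (intro power_increasing) auto
      then show ?thesis using npos by (intro add_right_mono divide_left_mono) auto
    qed
    also have "\<dots> = 4 / (real n ^ k * real n ^ 2)" by (simp add: power_add power2_eq_square)
    also have "\<dots> \<le> 1 / real n ^ k"
    proof -
      have "(2::real)\<^sup>2 \<le> real n ^ 2" using n(1) by (intro power_mono) auto
      then show ?thesis using npos by (simp add: field_simps)
    qed
    finally show "measure_pmf.prob (load_pmf P n m) (far n (20 * ln n / a)) \<le> 1 / real n ^ k" .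
  qed
qed

text \<open>The error exponents in the three stages are 24, 14 and 4; each stage supplies the range
  \<open>R\<close> for the next.\<close>

lemma biased_process_gap:
  assumes beta: "0 < \<beta>" "\<beta> \<le> 1"
    and P: "\<And>n. 2 \<le> n \<Longrightarrow> biased_process \<beta> P n"
  shows "\<exists>\<kappa>::real. \<kappa> > 0 \<and> (\<forall>\<^sub>F n in sequentially. \<forall>m::nat.
    measure_pmf.prob (load_pmf P n m) {x. gap n x \<le> \<kappa> * ln (real n)} \<ge> 1 - 1 / real n ^ 4)"
proof -
  obtain a0 e n0 where a0: "0 < a0" "a0 \<le> 1" and e: "0 < e" and tail:
    "\<And>P n a R k m. n0 \<le> n \<Longrightarrow>
      biased_process \<beta> P n \<Longrightarrow>
      0 < a \<Longrightarrow> a \<le> a0 \<Longrightarrow> 1 \<le> a\<^sup>2 * n \<Longrightarrow> 0 \<le> R \<Longrightarrow> R \<le> real n ^ 2 \<Longrightarrow> a\<^sup>2 * (R + 1) / n \<le> e \<Longrightarrow> k \<le> 14 \<Longrightarrow>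
      \<forall>t. measure_pmf.prob (load_pmf P n t) (far n R) \<le> 1 / real n ^ (k + 10) \<Longrightarrow>
      measure_pmf.prob (load_pmf P n m) (far n (20 * ln n / a)) \<le> 1 / real n ^ k"
    by (rule fine_tail[OF beta]) (rule that; assumption)
  \<comment> \<open>These are the conditions of \<open>fine_tail\<close> for both pairs of
    \<open>a\<close> and \<open>R\<close>. In the first stage \<open>a^2 * (R + 1) / n\<close> is of
    order \<open>1 / ln n\<close>, just small enough.\<close>
  have "\<forall>\<^sub>F n in sequentially. 1 / ln (real n) < a0" using a0 by real_asymp
  moreover have "\<forall>\<^sub>F n in sequentially. 1 \<le> (1 / ln (real n))\<^sup>2 * real n" by real_asymp
  moreover have "\<forall>\<^sub>F n in sequentially. 672 / \<beta> * real n * ln (real n) \<le> real n ^ 2" using beta by real_asymp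
  moreover have "\<forall>\<^sub>F n in sequentially. (1 / ln (real n))\<^sup>2 * (672 / \<beta> * real n * ln (real n) + 1) / real n < e"
    using beta e by real_asymp
  moreover have "\<forall>\<^sub>F n in sequentially. 1 \<le> a0\<^sup>2 * real n" using a0 by real_asymp
  moreover have "\<forall>\<^sub>F n in sequentially. 20 * ln (real n) / (1 / ln (real n)) \<le> real n ^ 2" by real_asymp
  moreover have "\<forall>\<^sub>F n in sequentially. a0\<^sup>2 * (20 * ln (real n) / (1 / ln (real n)) + 1) / real n < e"
    using a0 e by real_asymp
  ultimately have "\<forall>\<^sub>F n in sequentially. \<forall>m.
    1 - 1 / real n ^ 4 \<le> measure_pmf.prob (load_pmf P n m) {x. gap n x \<le> 20 / a0 * ln (real n)}"
    using eventually_ge_at_top[of "max 2 n0"]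
  proof eventually_elim
    case (elim n)
    have n: "2 \<le> n" "n0 \<le> n" using elim by auto
    have ln: "0 < ln (real n)" using n by simp
    have 1: "measure_pmf.prob (load_pmf P n t) (far n (672 / \<beta> * n * ln n)) \<le> 1 / real n ^ (14 + 10)" for t
      using coarse_tail[OF n(1) beta P[OF n(1)], of t] by simp
    have 2: "measure_pmf.prob (load_pmf P n t) (far n (20 * ln n / (1 / ln n))) \<le> 1 / real n ^ (4 + 10)" for t
      using elim ln beta 1 by (intro tail[OF n(2) P[OF n(1)], where R = "672 / \<beta> * n * ln n"]) auto
    have 3: "measure_pmf.prob (load_pmf P n m) (far n (20 * ln n / a0)) \<le> 1 / real n ^ 4" for m
      using elim ln a0 2 by (intro tail[OF n(2) P[OF n(1)], where R = "20 * ln n / (1 / ln n)"]) auto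
    have "- far n (20 * ln n / a0) \<subseteq> {x. gap n x \<le> 20 / a0 * ln n}"
    proof
      fix x assume "x \<in> - far n (20 * ln n / a0)"
      then have x: "\<bar>dev n x j\<bar> \<le> 20 * ln n / a0" if "j \<in> {1..n}" for j
        using that by (auto simp: far_def not_less)
      have "Max ((\<lambda>i. real (x i)) ` {1..n}) \<in> (\<lambda>i. real (x i)) ` {1..n}"
        using n by (intro Max_in) auto
      then obtain j where "j \<in> {1..n}" "gap n x = dev n x j" by (auto simp: gap_def dev_def)
      then show "x \<in> {x. gap n x \<le> 20 / a0 * ln n}" using x[of j] by simp
    qed
    then have sub: "measure_pmf.prob (load_pmf P n m) (- far n (20 * ln n / a0))
        \<le> measure_pmf.prob (load_pmf P n m) {x. gap n x \<le> 20 / a0 * ln n}" for m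
      by (intro measure_pmf.finite_measure_mono) auto
    have compl: "measure_pmf.prob (load_pmf P n m) (- far n (20 * ln n / a0))
        = 1 - measure_pmf.prob (load_pmf P n m) (far n (20 * ln n / a0))" for m
      using measure_pmf.prob_compl[of "far n (20 * ln n / a0)" "load_pmf P n m"] by (simp add: Compl_eq_Diff_UNIV)
    show ?case
    proof
      fix m
      show "1 - 1 / real n ^ 4 \<le> measure_pmf.prob (load_pmf P n m) {x. gap n x \<le> 20 / a0 * ln (real n)}"
        using sub[of m] compl[of m] 3[of m] by linarith
    qed
  qed
  moreover have "0 < 20 / a0" using a0 by simp
  ultimately show ?thesis by blast
qed

section \<open>The individual processes\<close>

lemma card_over_add_under:
  fixes y :: "nat \<Rightarrow> real"
  shows "real (card {j \<in> {1..n}. 0 \<le> y j}) + real (card {j \<in> {1..n}. y j < 0}) = n"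
proof -
  have "{j \<in> {1..n}. 0 \<le> y j} \<union> {j \<in> {1..n}. y j < 0} = {1..n}" by auto
  then have "card {j \<in> {1..n}. 0 \<le> y j} + card {j \<in> {1..n}. y j < 0} = card {1..n}"
    by (subst card_Un_disjoint[symmetric]) auto
  then show ?thesis by simp
qed

lemma dev_less_iff: "dev n x i < dev n x j \<longleftrightarrow> x i < x j"
  by (simp add: dev_def)

lemma sum_pmf_1: "set_pmf q \<subseteq> {1..n::nat} \<Longrightarrow> (\<Sum>j\<in>{1..n}. pmf q j) = 1"
  by (intro sum_pmf_eq_1) auto

text \<open>With one ball per round the mean rate is \<open>1/n\<close>, and
  \<open>rate_over\<close> becomes a bound on the probability that an overloaded bin is
  chosen.\<close>

lemma single_ball_biased:
  fixes \<beta> :: real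
  assumes n: "2 \<le> n" and beta: "0 < \<beta>" "\<beta> \<le> 1"
    and set: "set_pmf q \<subseteq> {1..n}"
    and le: "\<And>i. pmf q i \<le> 2 / n"
    and mono: "\<And>i j. i \<in> {1..n} \<Longrightarrow> j \<in> {1..n} \<Longrightarrow> x i < x j \<Longrightarrow> pmf q j \<le> pmf q i"
    and over: "(\<Sum>j | j \<in> {1..n} \<and> 0 \<le> dev n x j. pmf q j)
      \<le> real (card {j \<in> {1..n}. 0 \<le> dev n x j}) / real n
        - \<beta> * real (card {j \<in> {1..n}. 0 \<le> dev n x j}) * real (card {j \<in> {1..n}. dev n x j < 0}) / (real n)\<^sup>2"
  shows "biased_allocation \<beta> n x (map_pmf (\<lambda>i. add_balls 1 i x) q)"
  unfolding biased_allocation_def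
proof (intro exI conjI)
  have one: "(\<Sum>j\<in>{1..n}. pmf q j) = 1" using sum_pmf_1[OF set] .
  show "biased_step n (dev n x) (pmf q) (\<lambda>i. real (1::nat)) \<beta>"
  proof
    show "(\<Sum>j | j \<in> {1..n} \<and> 0 \<le> dev n x j. pmf q j * real 1 - (\<Sum>i\<in>{1..n}. pmf q i * real 1) / n)
      \<le> - \<beta> * card {j \<in> {1..n}. 0 \<le> dev n x j} * card {j \<in> {1..n}. dev n x j < 0} / n\<^sup>2"
      using over one by (simp add: sum_subtractf)
  qed (use n beta one le mono sum_dev in \<open>auto simp: dev_less_iff\<close>)
qed (use set in auto)

section \<open>Rules that choose between two sampled bins\<close>

definition choice_pmf :: "nat \<Rightarrow> (nat \<Rightarrow> nat \<Rightarrow> nat) \<Rightarrow> nat pmf" where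
  "choice_pmf n c = map_pmf (\<lambda>(i1, i2). c i1 i2) (two_samples n)"

lemma prob_choice_pmf:
  assumes n: "2 \<le> n"
  shows "measure_pmf.prob (choice_pmf n c) A = card {(i, j) \<in> {1..n} \<times> {1..n}. c i j \<in> A} / n\<^sup>2"
proof -
  have "two_samples n = pmf_of_set ({1..n} \<times> {1..n})"
    using n by (intro pmf_eqI)
      (auto simp: two_samples_def one_sample_def pmf_pair indicator_def card_cartesian_product split: if_splits)
  moreover have "{1..n} \<times> {1..n} \<inter> (\<lambda>(i1, i2). c i1 i2) -` A = {(i, j) \<in> {1..n} \<times> {1..n}. c i j \<in> A}"
    by auto
  ultimately show ?thesis
    using n by (simp add: choice_pmf_def measure_pmf_of_set card_cartesian_product power2_eq_square)
qed

lemma set_choice_pmf: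
  assumes "2 \<le> n" "\<And>i j. c i j = i \<or> c i j = j"
  shows "set_pmf (choice_pmf n c) \<subseteq> {1..n}"
proof
  fix k assume "k \<in> set_pmf (choice_pmf n c)"
  then obtain i j where "i \<in> {1..n}" "j \<in> {1..n}" "k = c i j"
    using assms(1) by (auto simp: choice_pmf_def two_samples_def one_sample_def)
  then show "k \<in> {1..n}" using assms(2)[of i j] by auto
qed

text \<open>\<open>swap\<close>: exchanging the labels of a heavier bin \<open>j\<close> and a
  lighter bin \<open>i\<close> in a pair that selects \<open>j\<close> gives a pair that selects
  \<open>i\<close>. Together with \<open>prefers_under\<close> this yields the two bias
  conditions.\<close>

locale choice_rule =
  fixes n :: nat and x :: loads and c :: "nat \<Rightarrow> nat \<Rightarrow> nat"
  assumes n_ge_2: "2 \<le> n"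
    and choice: "\<And>i j. c i j = i \<or> c i j = j"
    and prefers_under: "\<And>i j. i \<in> {1..n} \<Longrightarrow> j \<in> {1..n} \<Longrightarrow> dev n x i < 0 \<Longrightarrow> 0 \<le> dev n x j \<Longrightarrow> c i j = i \<and> c j i = i"
    and swap: "\<And>i j k l. i \<in> {1..n} \<Longrightarrow> j \<in> {1..n} \<Longrightarrow> k \<in> {1..n} \<Longrightarrow> l \<in> {1..n} \<Longrightarrow> x i < x j \<Longrightarrow> c k l = j \<Longrightarrow>
      c (Transposition.transpose i j k) (Transposition.transpose i j l) = i"
begin

lemma set_choice: "set_pmf (choice_pmf n c) \<subseteq> {1..n}"
  by (rule set_choice_pmf[OF n_ge_2 choice])

lemma pmf_choice: "pmf (choice_pmf n c) k = card {(i, j) \<in> {1..n} \<times> {1..n}. c i j = k} / n\<^sup>2"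
  using prob_choice_pmf[OF n_ge_2, of c "{k}"] by (simp add: measure_pmf_single)

lemma pmf_choice_le: "pmf (choice_pmf n c) k \<le> 2 / n"
proof -
  have "{(i, j) \<in> {1..n} \<times> {1..n}. c i j = k} \<subseteq> {k} \<times> {1..n} \<union> {1..n} \<times> {k}"
  proof
    fix z assume "z \<in> {(i, j) \<in> {1..n} \<times> {1..n}. c i j = k}"
    then obtain i j where "z = (i, j)" "i \<in> {1..n}" "j \<in> {1..n}" "c i j = k" by blast
    then show "z \<in> {k} \<times> {1..n} \<union> {1..n} \<times> {k}" using choice[of i j] by auto
  qed
  then have "card {(i, j) \<in> {1..n} \<times> {1..n}. c i j = k} \<le> card ({k} \<times> {1..n} \<union> {1..n} \<times> {k})"
    by (intro card_mono) auto
  also have "\<dots> \<le> card ({k} \<times> {1..n}) + card ({1..n} \<times> {k})" by (rule card_Un_le)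
  also have "\<dots> = 2 * n" by (simp add: card_cartesian_product)
  finally have "pmf (choice_pmf n c) k \<le> real (2 * n) / n\<^sup>2"
    unfolding pmf_choice by (intro divide_right_mono) auto
  then show ?thesis using n_ge_2 by (simp add: power2_eq_square)
qed

text \<open>Transposing \<open>i\<close> and \<open>j\<close> in both samples injects the pairs that
  select \<open>j\<close> into those that select \<open>i\<close>.\<close>

lemma pmf_choice_mono:
  assumes "i \<in> {1..n}" "j \<in> {1..n}" "x i < x j"
  shows "pmf (choice_pmf n c) j \<le> pmf (choice_pmf n c) i"
proof -
  let ?s = "Transposition.transpose i j"
  have "card {(k, l) \<in> {1..n} \<times> {1..n}. c k l = j} \<le> card {(k, l) \<in> {1..n} \<times> {1..n}. c k l = i}"
  proof (rule card_inj_on_le)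
    show "inj_on (map_prod ?s ?s) {(k, l) \<in> {1..n} \<times> {1..n}. c k l = j}"
      by (intro inj_on_subset[OF prod.inj_map]) auto
    show "map_prod ?s ?s ` {(k, l) \<in> {1..n} \<times> {1..n}. c k l = j} \<subseteq> {(k, l) \<in> {1..n} \<times> {1..n}. c k l = i}"
    proof (rule image_subsetI)
      fix z assume "z \<in> {(k, l) \<in> {1..n} \<times> {1..n}. c k l = j}"
      then obtain k l where kl: "z = (k, l)" "k \<in> {1..n}" "l \<in> {1..n}" "c k l = j" by blast
      have "?s k \<in> {1..n}" "?s l \<in> {1..n}" using kl(2,3) assms by (auto simp: Transposition.transpose_def)
      moreover have "c (?s k) (?s l) = i" using swap[OF assms(1,2) kl(2,3) assms(3) kl(4)] .
      ultimately show "map_prod ?s ?s z \<in> {(k, l) \<in> {1..n} \<times> {1..n}. c k l = i}"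
        by (simp add: kl(1))
    qed
    show "finite {(k, l) \<in> {1..n} \<times> {1..n}. c k l = i}"
      by (rule finite_subset[of _ "{1..n} \<times> {1..n}"]) auto
  qed
  then show ?thesis unfolding pmf_choice by (intro divide_right_mono) auto
qed

text \<open>An overloaded bin is selected exactly if both samples are overloaded. For an overloaded
  fraction \<delta> this has probability
  \<open>\<delta>^2 = \<delta> - \<delta> * (1 - \<delta>)\<close>.\<close>

lemma choice_over:
  defines "ov \<equiv> {j \<in> {1..n}. 0 \<le> dev n x j}" and "un \<equiv> {j \<in> {1..n}. dev n x j < 0}"
  shows "(\<Sum>j\<in>ov. pmf (choice_pmf n c) j) = real (card ov) / n - real (card ov) * real (card un) / n\<^sup>2"
proof -
  have "{(i, j) \<in> {1..n} \<times> {1..n}. c i j \<in> ov} = ov \<times> ov"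
  proof (intro set_eqI iffI; clarify)
    fix i j assume ij: "i \<in> {1..n}" "j \<in> {1..n}" "c i j \<in> ov"
    then show "i \<in> ov \<and> j \<in> ov"
      using choice[of i j] prefers_under[of i j] prefers_under[of j i] unfolding ov_def
      by (metis (mono_tags, lifting) linorder_not_less mem_Collect_eq)
  next
    fix i j assume "i \<in> ov" "j \<in> ov"
    then show "(i, j) \<in> {1..n} \<times> {1..n} \<and> c i j \<in> ov" using choice[of i j] by (auto simp: ov_def)
  qed
  then have "measure_pmf.prob (choice_pmf n c) ov = real (card ov * card ov) / n\<^sup>2"
    using prob_choice_pmf[OF n_ge_2, of c ov] by (simp add: card_cartesian_product)
  moreover have "measure_pmf.prob (choice_pmf n c) ov = (\<Sum>j\<in>ov. pmf (choice_pmf n c) j)"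
    by (intro measure_measure_pmf_finite) (simp add: ov_def)
  moreover
  have "real (card ov) + card un = n"
    unfolding ov_def un_def by (rule card_over_add_under)
  then have "real (card un) = n - real (card ov)" by simp
  then have "real (card ov) / n - real (card ov) * real (card un) / n\<^sup>2 = real (card ov * card ov) / n\<^sup>2"
    using n_ge_2 by (simp only:) (simp add: power2_eq_square field_simps)
  ultimately show ?thesis by simp
qed

lemma choice_biased: "biased_allocation 1 n x (map_pmf (\<lambda>i. add_balls 1 i x) (choice_pmf n c))"
  using n_ge_2 set_choice pmf_choice_le pmf_choice_mono choice_over by (intro single_ball_biased) auto

text \<open>Uniform sampling has no bias, so mixing multiplies the bias of the choice rule by
  \<open>\<beta>\<close>.\<close>

lemma mixture_biased:
  assumes beta: "0 < \<beta>" "\<beta> \<le> 1"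
  shows "biased_allocation \<beta> n x (map_pmf (\<lambda>i. add_balls 1 i x)
    (bind_pmf (bernoulli_pmf \<beta>) (\<lambda>b. if b then choice_pmf n c else one_sample n)))"
proof -
  let ?q = "bind_pmf (bernoulli_pmf \<beta>) (\<lambda>b. if b then choice_pmf n c else one_sample n)"
  have pmf: "pmf ?q i = \<beta> * pmf (choice_pmf n c) i + (1 - \<beta>) * (if i \<in> {1..n} then 1 / n else 0)" for i
    using beta n_ge_2 by (simp add: pmf_bind one_sample_def indicator_def)
  show ?thesis
  proof (rule single_ball_biased[OF n_ge_2 beta])
    show "set_pmf ?q \<subseteq> {1..n}" using set_choice n_ge_2
      by (auto simp: one_sample_def split: if_splits)
    show "pmf ?q i \<le> 2 / n" for i
    proof -
      have "pmf ?q i \<le> \<beta> * (2 / n) + (1 - \<beta>) * (2 / n)"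
        unfolding pmf using beta pmf_choice_le by (intro add_mono mult_left_mono) (auto simp: divide_right_mono)
      then show ?thesis by (simp only: distrib_right[symmetric]) simp
    qed
    show "pmf ?q j \<le> pmf ?q i" if "i \<in> {1..n}" "j \<in> {1..n}" "x i < x j" for i j
      using that beta pmf_choice_mono[OF that] unfolding pmf by (simp add: mult_left_mono)
    let ?o = "{j \<in> {1..n}. 0 \<le> dev n x j}" and ?u = "{j \<in> {1..n}. dev n x j < 0}"
    have "(\<Sum>j\<in>?o. if j \<in> {1..n} then 1 / real n else 0) = (\<Sum>j\<in>?o. 1 / real n)"
      by (intro sum.cong) auto
    then have "(\<Sum>j\<in>?o. pmf ?q j) = \<beta> * (\<Sum>j\<in>?o. pmf (choice_pmf n c) j) + (1 - \<beta>) * (\<Sum>j\<in>?o. 1 / n)"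
      unfolding pmf sum.distrib sum_distrib_left[symmetric] by (simp only:)
    also have "\<dots> = real (card ?o) / real n - \<beta> * real (card ?o) * real (card ?u) / (real n)\<^sup>2"
      unfolding choice_over by (simp add: algebra_simps diff_divide_distrib add_divide_distrib)
    finally show "(\<Sum>j\<in>?o. pmf ?q j) \<le> real (card ?o) / real n - \<beta> * real (card ?o) * real (card ?u) / (real n)\<^sup>2" by simp
  qed
qed

end

text \<open>With \<open>u\<close> underloaded bins a round adds \<open>1 + u / n\<close> balls on
  average, so an overloaded bin has bias \<open>1/n - (1 + u / n) / n = - u / n^2\<close>. Summation
  gives \<open>rate_over\<close> with equality.\<close>

lemma twinning_biased:
  assumes n: "2 \<le> n"
  shows "biased_allocation 1 n x (twinning n t x)"
  unfolding biased_allocation_def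
proof (intro exI conjI)
  define W :: "nat \<Rightarrow> nat" where "W i = (if real (x i) < real (total_load n x) / real n then 2 else 1)" for i
  show "twinning n t x = map_pmf (\<lambda>i. add_balls (W i) i x) (one_sample n)"
    unfolding twinning_def W_def ..
  show "set_pmf (one_sample n) \<subseteq> {1..n}" using n by (simp add: one_sample_def)
  have W: "real (W j) = (if dev n x j < 0 then 2 else 1)" for j by (simp add: W_def dev_def)
  have q: "pmf (one_sample n) j = 1 / n" if "j \<in> {1..n}" for j
    using that n by (simp add: one_sample_def)
  let ?o = "{j \<in> {1..n}. 0 \<le> dev n x j}" and ?u = "{j \<in> {1..n}. dev n x j < 0}"
  have ou: "real (card ?o) + card ?u = n" by (rule card_over_add_under)
  have "(\<Sum>i\<in>{1..n}. pmf (one_sample n) i * real (W i)) = (\<Sum>i\<in>{1..n}. 1 / n + (if dev n x i < 0 then 1 / n else 0))"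
    using q by (intro sum.cong) (auto simp: W)
  also have "\<dots> = 1 + card ?u / n"
    using n by (simp add: sum.distrib sum.If_cases Int_def)
  finally have mean: "(\<Sum>i\<in>{1..n}. pmf (one_sample n) i * real (W i)) = 1 + card ?u / n" .
  show "biased_step n (dev n x) (pmf (one_sample n)) (\<lambda>i. real (W i)) 1"
  proof
    have "(\<Sum>j\<in>?o. pmf (one_sample n) j * real (W j) - (1 + card ?u / n) / n)
      = (\<Sum>j\<in>?o. - (real (card ?u) / real (n\<^sup>2)))"
      using q by (intro sum.cong) (auto simp: W power2_eq_square add_divide_distrib)
    then show "(\<Sum>j | j \<in> {1..n} \<and> 0 \<le> dev n x j. pmf (one_sample n) j * real (W j)
        - (\<Sum>i\<in>{1..n}. pmf (one_sample n) i * real (W i)) / n) \<le> - (1::real) * real (card ?o) * real (card ?u) / real (n\<^sup>2)"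
      unfolding mean by simp
    show "(\<Sum>j\<in>{1..n}. pmf (one_sample n) j) = 1"
      using n by (intro sum_pmf_1) (simp add: one_sample_def)
  qed (use n q in \<open>auto simp: W sum_dev divide_right_mono\<close>)
qed

section \<open>Thresholds relative to the average load\<close>

lemma total_load_single:
  assumes P: "\<And>t x. \<exists>q. P n t x = map_pmf (\<lambda>i. add_balls 1 i x) q \<and> set_pmf q \<subseteq> {1..n}"
  shows "x \<in> set_pmf (load_pmf P n t) \<Longrightarrow> total_load n x = t"
proof (induction t arbitrary: x)
  case 0
  then show ?case by (simp add: total_load_def)
next
  case (Suc t)
  then obtain z where z: "z \<in> set_pmf (load_pmf P n t)" "x \<in> set_pmf (P n t z)" by auto
  obtain q where q: "P n t z = map_pmf (\<lambda>i. add_balls 1 i z) q" "set_pmf q \<subseteq> {1..n}"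
    using P by blast
  then obtain i where "i \<in> {1..n}" "x = add_balls 1 i z" using z(2) by auto
  then show ?case using Suc.IH[OF z(1)] by (simp add: total_load_add_balls)
qed

text \<open>One ball per round makes the total load of reachable vectors equal to \<open>t\<close>,
  so \<open>rule\<close> is demanded only for those: there \<open>t / n\<close> is the mean
  load.\<close>

lemma choice_process:
  assumes n: "2 \<le> n"
    and P: "\<And>t x. P n t x = map_pmf (\<lambda>i. add_balls 1 i x) (choice_pmf n (c t x))"
    and choice: "\<And>t x i j. c t x i j = i \<or> c t x i j = j"
    and rule: "\<And>t x. total_load n x = t \<Longrightarrow> choice_rule n x (c t x)"
  shows "biased_process 1 P n"
  unfolding biased_process_def
proof (intro allI ballI)
  fix t x assume x: "x \<in> set_pmf (load_pmf P n t)"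
  have "total_load n x = t"
  proof (rule total_load_single[OF _ x])
    fix t x
    have "set_pmf (choice_pmf n (c t x)) \<subseteq> {1..n}" by (rule set_choice_pmf[OF n]) (rule choice)
    then show "\<exists>q. P n t x = map_pmf (\<lambda>i. add_balls 1 i x) q \<and> set_pmf q \<subseteq> {1..n}" using P by blast
  qed
  then show "biased_allocation 1 n x (P n t x)"
    unfolding P by (intro choice_rule.choice_biased rule)
qed

lemma level_mono:
  assumes f0: "f 0 n = \<infinity>" and le: "x i \<le> x j"
  shows "level k f n t x j \<le> level k f n t x i"
proof -
  have "ereal (real (x i)) \<le> ereal (real (x j))" using le by simp
  then have "{l \<in> {0..k}. ereal (real t / real n) + f l n > ereal (real (x j))}
      \<subseteq> {l \<in> {0..k}. ereal (real t / real n) + f l n > ereal (real (x i))}"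
    by (blast intro: le_less_trans)
  moreover have "0 \<in> {l \<in> {0..k}. ereal (real t / real n) + f l n > ereal (real (x j))}"
    using f0 by simp
  ultimately show ?thesis unfolding level_def by (intro Max_mono) (auto simp del: mem_Collect_eq)
qed

text \<open>The last threshold being 0 identifies the highest level with the bins below
  \<open>t / n\<close>; the infinite threshold \<open>f 0 n\<close> keeps the set of levels
  nonempty.\<close>

lemma level_eq_k_iff:
  assumes f0: "f 0 n = \<infinity>" and fk: "f k n = 0"
  shows "level k f n t x i = k \<longleftrightarrow> real (x i) < real t / real n" "level k f n t x i \<le> k"
proof -
  let ?L = "{l \<in> {0..k}. ereal (real t / real n) + f l n > ereal (real (x i))}"
  have L: "finite ?L" "0 \<in> ?L" using f0 by auto
  then have M: "Max ?L \<in> ?L" by (intro Max_in) auto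
  then show "level k f n t x i \<le> k" by (simp add: level_def)
  have "k \<in> ?L \<longleftrightarrow> real (x i) < real t / real n" using fk by simp
  moreover have "Max ?L = k \<longleftrightarrow> k \<in> ?L"
  proof
    assume "k \<in> ?L"
    then have "k \<le> Max ?L" using L(1) by (intro Max_ge)
    then show "Max ?L = k" using M by auto
  qed (use M in metis)
  ultimately show "level k f n t x i = k \<longleftrightarrow> real (x i) < real t / real n" unfolding level_def by blast
qed

lemma relative_threshold_biased:
  assumes n: "2 \<le> n" and f: "relative_thresholds k f" "\<forall>n\<ge>1. f k n = 0"
  shows "biased_process 1 (relative_threshold k f) n"
proof (rule choice_process[OF n])
  have f0: "f 0 n = \<infinity>" and fk: "f k n = 0" using f n by (auto simp: relative_thresholds_def)
  let ?c = "\<lambda>t x i j. if level k f n t x j \<le> level k f n t x i then i else j"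
  show "relative_threshold k f n t x = map_pmf (\<lambda>i. add_balls 1 i x) (choice_pmf n (?c t x))" for t x
    by (simp add: relative_threshold_def choice_pmf_def map_pmf_comp case_prod_unfold)
  show "?c t x i j = i \<or> ?c t x i j = j" for t x i j by simp
  fix t x assume t: "total_load n x = t"
  let ?L = "level k f n t x"
  have L: "?L i = k \<longleftrightarrow> dev n x i < 0" "?L i \<le> k" for i
    using level_eq_k_iff[of f n k, OF f0 fk] by (simp_all add: dev_def t)
  show "choice_rule n x (?c t x)"
  proof
    fix i j assume "dev n x i < 0" "0 \<le> dev n x j"
    then have "?L i = k" "?L j < k" using L(1)[of i] L(1)[of j] L(2)[of j] by auto
    then show "(if ?L j \<le> ?L i then i else j) = i \<and> (if ?L i \<le> ?L j then j else i) = i" by simp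
  next
    fix i j a b assume x: "x i < x j" and c: "(if ?L b \<le> ?L a then a else b) = j"
    \<comment> \<open>The lighter bin has at least the level of the heavier one, and the exchange
      preserves positions in the pair, so ties still favour the first sample.\<close>
    have "?L j \<le> ?L i" using x by (intro level_mono[of f n, OF f0]) simp
    then show "(if ?L (Transposition.transpose i j b) \<le> ?L (Transposition.transpose i j a)
      then Transposition.transpose i j a else Transposition.transpose i j b) = i"
      using c x by (auto simp: Transposition.transpose_def split: if_splits)
  qed (use n in auto)
qed

text \<open>Of two overloaded bins this rule takes the second sample, whereas the relative threshold
  rule with \<open>k = 1\<close> takes the first. It is therefore checked as a choice rule of its
  own.\<close>

lemma mean_thinning_biased:
  assumes n: "2 \<le> n"
  shows "biased_process 1 mean_thinning n"
proof (rule choice_process[OF n])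
  let ?c = "\<lambda>t x i j. if real (x i) < real t / real n then i else j"
  show "mean_thinning n t x = map_pmf (\<lambda>i. add_balls 1 i x) (choice_pmf n (?c t x))" for t x
    by (simp add: mean_thinning_def choice_pmf_def map_pmf_comp case_prod_unfold)
  show "?c t x i j = i \<or> ?c t x i j = j" for t x i j by simp
  fix t :: nat and x assume t: "total_load n x = t"
  have c: "?c t x = (\<lambda>i j. if dev n x i < 0 then i else j)" by (simp add: dev_def t)
  show "choice_rule n x (?c t x)" unfolding c
  proof
    fix i j a b assume "x i < x j" "(if dev n x a < 0 then a else b) = j"
    moreover from this have "dev n x i < dev n x j" by (simp add: dev_less_iff)
    ultimately show "(if dev n x (Transposition.transpose i j a) < 0
      then Transposition.transpose i j a else Transposition.transpose i j b) = i"
      by (auto simp: Transposition.transpose_def split: if_splits)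
  qed (use n in auto)
qed

lemma one_plus_beta_biased:
  assumes n: "2 \<le> n" and beta: "0 < \<beta>" "\<beta> \<le> 1"
  shows "biased_process \<beta> (one_plus_beta \<beta>) n"
  unfolding biased_process_def
proof (intro allI ballI)
  fix t x
  have "choice_rule n x (less_loaded x)"
  proof
    fix i j assume "dev n x i < 0" "0 \<le> dev n x j"
    then have "x i < x j" using dev_less_iff[of n x i j] by linarith
    then show "less_loaded x i j = i \<and> less_loaded x j i = i" by (simp add: less_loaded_def)
  next
    \<comment> \<open>If \<open>j\<close> is selected, any other bin in the pair is at least as
      loaded as \<open>j\<close>, hence strictly more loaded than \<open>i\<close>; after the
      exchange no tie between different bins remains.\<close>
    fix i j a b assume "x i < x j" "less_loaded x a b = j"
    then show "less_loaded x (Transposition.transpose i j a) (Transposition.transpose i j b) = i"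
      by (auto simp: less_loaded_def Transposition.transpose_def max_def split: if_splits)
  qed (use n in \<open>auto simp: less_loaded_def max_def\<close>)
  moreover have "one_plus_beta \<beta> n t x = map_pmf (\<lambda>i. add_balls 1 i x)
    (bind_pmf (bernoulli_pmf \<beta>) (\<lambda>b. if b then choice_pmf n (less_loaded x) else one_sample n))"
    unfolding one_plus_beta_def map_bind_pmf
    by (intro bind_pmf_cong) (auto simp: choice_pmf_def map_pmf_comp case_prod_unfold)
  ultimately show "biased_allocation \<beta> n x (one_plus_beta \<beta> n t x)"
    using choice_rule.mixture_biased[OF _ beta] by simp
qed

theorem corollary3p11:
  fixes P :: alloc_process
  assumes "P = twinning
    \<or> (\<exists>(k::nat) (f :: nat \<Rightarrow> nat \<Rightarrow> ereal). k \<ge> 1 \<and> relative_thresholds k f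
          \<and> (\<forall>n\<ge>1. f k n = 0) \<and> P = relative_threshold k f)
    \<or> P = mean_thinning
    \<or> (\<exists>\<beta>::real. 0 < \<beta> \<and> \<beta> \<le> 1 \<and> P = one_plus_beta \<beta>)"
  shows "\<exists>\<kappa>::real. \<kappa> > 0 \<and> (\<forall>\<^sub>F n in sequentially. \<forall>m::nat.
    measure_pmf.prob (load_pmf P n m) {x. gap n x \<le> \<kappa> * ln (real n)} \<ge> 1 - 1 / real n ^ 4)"
proof -
  have twinning: "biased_process 1 twinning n" if "2 \<le> n" for n
    unfolding biased_process_def using twinning_biased[OF that] by blast
  obtain \<beta> :: real where "0 < \<beta>" "\<beta> \<le> 1" "\<And>n. 2 \<le> n \<Longrightarrow> biased_process \<beta> P n"
    using assms
  proof (elim disjE exE conjE)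
    assume "P = twinning"
    then show thesis using twinning by (intro that[of 1]) auto
  next
    fix k f assume "relative_thresholds k f" "\<forall>n\<ge>1. f k n = 0" "P = relative_threshold k f"
    then show thesis using relative_threshold_biased by (intro that[of 1]) auto
  next
    assume "P = mean_thinning"
    then show thesis using mean_thinning_biased by (intro that[of 1]) auto
  next
    fix \<beta> :: real assume "0 < \<beta>" "\<beta> \<le> 1" "P = one_plus_beta \<beta>"
    then show thesis using one_plus_beta_biased by (intro that[of \<beta>]) auto
  qed
  then show ?thesis by (rule biased_process_gap)
qed

end
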